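(* Let $\eta$ be a finite Borel measure on $[0,1)$ and $\mu=\nu_\eta$. Then the following conditions are equivalent: (a) $T_\mu$ is a bounded operator on $A^2(\mathbb{D})$; (b) $\beta_\eta$ is a bounded function on $[0,1)$; (c) $\gamma_\eta$ is a bounded sequence; (d) $\varkappa_\eta$ is a bounded function on $[0,1)$.
   Context: $\mathbb{D}$ is the open unit disk, $\mathbb{T}$ the unit circle, $\mathbb{N}_0=\{0,1,2,\ldots\}$. $A^2(\mathbb{D})$ is the Bergman space of analytic functions in $L_2(\mathbb{D},\lambda_{\mathbb{C}})$, $\lambda_{\mathbb{C}}$ being the Lebesgue plane measure. Measures are positive. $\nu_\eta$ is the pushforward of $\eta\times\lambda_{\mathbb{T}}$ under $[0,1)\times\mathbb{T}\to\mathbb{D}$, $(r,\tau)\mapsto r\tau$, where $\lambda_{\mathbb{T}}$ is the Haar measure on $\mathbb{T}$ with $\lambda_{\mathbb{T}}(\mathbb{T})=2\pi$. For a finite Borel measure $\mu$ on $\mathbb{D}$, the Toeplitz operator $T_\mu$ is defined on a dense subset of $A^2(\mathbb{D})$ (take the analytic polynomials) by $(T_\mu f)(z)=\frac1\pi\int_{\mathbb{D}}\frac{f(w)}{(1-z\overline{w})^2}\,\mathrm{d}\mu(w)$; "$T_\mu$ is bounded" means that it extends to a bounded linear operator on $A^2(\mathbb{D})$. For a finite Borel measure $\eta$ on $[0,1)$ define $\beta_\eta(a)=2(1-a^2)^2\int_{[0,1)}\frac{1+a^2r^2}{(1-a^2r^2)^3}\,\mathrm{d}\eta(r)$ for $a\in[0,1)$;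 $\gamma_\eta(k)=2(k+1)\int_{[0,1)}r^{2k}\,\mathrm{d}\eta(r)$ for $k\in\mathbb{N}_0$; $\varkappa_\eta(r)=\frac{2\,\eta([r,1))}{1-r^2}$ for $r\in[0,1)$. *)

theory Defs
  imports "HOL-Complex_Analysis.Complex_Analysis" "HOL-Computational_Algebra.Polynomial"
begin

abbreviation unit_disk :: "complex set" where
  "unit_disk \<equiv> ball 0 1"

text \<open>Elements of the Bergman space are functions on the disk; they are represented by total
  functions vanishing off the disk, so that the representation is unique and pointwise operations
  on total functions are the vector space operations.\<close>

definition bergman_space :: "(complex \<Rightarrow> complex) set" where
  "bergman_space =
    {f. f holomorphic_on unit_disk \<and>
        set_integrable lborel unit_disk (\<lambda>z. (norm (f z))\<^sup>2) \<and>
        (\<forall>z. z \<notin> unit_disk \<longrightarrow> f z = 0)}"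

definition bergman_norm :: "(complex \<Rightarrow> complex) \<Rightarrow> real" where
  "bergman_norm f = sqrt (LINT z:unit_disk|lborel. (norm (f z))\<^sup>2)"

definition bergman_bounded_operator ::
    "((complex \<Rightarrow> complex) \<Rightarrow> (complex \<Rightarrow> complex)) \<Rightarrow> bool" where
  "bergman_bounded_operator T \<longleftrightarrow>
    T \<in> bergman_space \<rightarrow> bergman_space \<and>
    (\<forall>f\<in>bergman_space. \<forall>g\<in>bergman_space. T (\<lambda>z. f z + g z) = (\<lambda>z. T f z + T g z)) \<and>
    (\<forall>c. \<forall>f\<in>bergman_space. T (\<lambda>z. c * f z) = (\<lambda>z. c * T f z)) \<and>
    (\<exists>C. \<forall>f\<in>bergman_space. bergman_norm (T f) \<le> C * bergman_norm f)"

definition disk_poly :: "complex poly \<Rightarrow> complex \<Rightarrow> complex" where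
  "disk_poly p z = (if z \<in> unit_disk then poly p z else 0)"

definition toeplitz :: "complex measure \<Rightarrow> (complex \<Rightarrow> complex) \<Rightarrow> complex \<Rightarrow> complex" where
  "toeplitz \<mu> f z = (1 / of_real pi) * (LINT w|\<mu>. f w / (1 - z * cnj w)\<^sup>2)"

text \<open>The Toeplitz operator has the analytic polynomials as its domain; boundedness means that it
  extends to an everywhere defined bounded operator.\<close>

definition toeplitz_bounded :: "complex measure \<Rightarrow> bool" where
  "toeplitz_bounded \<mu> \<longleftrightarrow>
    (\<exists>T. bergman_bounded_operator T \<and>
         (\<forall>p. \<forall>z\<in>unit_disk. T (disk_poly p) z = toeplitz \<mu> (disk_poly p) z))"

text \<open>The Haar measure on the unit circle of total mass \<open>2 * pi\<close>, realised as arc length.\<close>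

definition circle_measure :: "complex measure" where
  "circle_measure =
    distr (restrict_space lborel {0..<2 * pi}) (restrict_space borel (sphere 0 1)) cis"

definition radial_measure :: "real measure \<Rightarrow> complex measure" where
  "radial_measure \<eta> =
    distr (\<eta> \<Otimes>\<^sub>M circle_measure) (restrict_space borel unit_disk) (\<lambda>(r, \<tau>). of_real r * \<tau>)"

definition beta_fun :: "real measure \<Rightarrow> real \<Rightarrow> real" where
  "beta_fun \<eta> a =
    2 * (1 - a\<^sup>2)\<^sup>2 * (LINT r|\<eta>. (1 + a\<^sup>2 * r\<^sup>2) / (1 - a\<^sup>2 * r\<^sup>2) ^ 3)"

definition gamma_seq :: "real measure \<Rightarrow> nat \<Rightarrow> real" where
  "gamma_seq \<eta> k = 2 * (real k + 1) * (LINT r|\<eta>. r ^ (2 * k))"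

definition kappa_fun :: "real measure \<Rightarrow> real \<Rightarrow> real" where
  "kappa_fun \<eta> r = 2 * measure \<eta> {r..<1} / (1 - r\<^sup>2)"

lemma cis_measurable_circle:
  "cis \<in> measurable (restrict_space lborel {0..<2 * pi}) (restrict_space borel (sphere 0 1))"
proof (rule measurable_restrict_space2)
  have "cis \<in> borel_measurable borel"
    by (intro borel_measurable_continuous_onI continuous_intros)
  then show "cis \<in> borel_measurable (restrict_space lborel {0..<2 * pi})"
    by (intro measurable_restrict_space1) simp
qed simp

lemma circle_measure_mass: "emeasure circle_measure (sphere 0 1) = ennreal (2 * pi)"
proof -
  have "emeasure circle_measure (sphere 0 1) =
      emeasure (restrict_space lborel {0..<2 * pi}) (cis -` sphere 0 1 \<inter> {0..<2 * pi})"
    unfolding circle_measure_def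
    by (subst emeasure_distr[OF cis_measurable_circle])
       (auto simp: sets_restrict_space space_restrict_space)
  also have "cis -` sphere 0 1 \<inter> {0..<2 * pi} = {0..<2 * pi}" by auto
  finally show ?thesis
    by (simp add: emeasure_restrict_space)
qed

lemma circle_measure_rotation:
  assumes "norm u = 1"
  shows "distr circle_measure circle_measure (\<lambda>\<tau>. u * \<tau>) = circle_measure"
proof -
  define t where "t = Arg2pi u"
  have t: "0 \<le> t" "t < 2 * pi" "u = cis t"
    using Arg2pi[of u] assms by (auto simp: t_def is_Arg_def cis_conv_exp)
  let ?S = "restrict_space borel (sphere 0 1) :: complex measure"
  let ?I = "restrict_space lborel {0..<2 * pi} :: real measure"
  have M: "(\<lambda>\<tau>. u * \<tau>) \<in> measurable ?S ?S"
    by (rule measurable_restrict_space3) (auto simp: norm_mult assms)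
  have S: "sets circle_measure = sets ?S" by (simp add: circle_measure_def)
  have cm: "cis \<in> borel_measurable borel"
    by (intro borel_measurable_continuous_onI continuous_intros)
  have em: "emeasure circle_measure A = emeasure lborel ({0..<2 * pi} \<inter> cis -` A)"
    if A: "A \<in> sets ?S" for A
  proof -
    have "emeasure circle_measure A = emeasure ?I (cis -` A \<inter> {0..<2 * pi})"
      unfolding circle_measure_def
      using A by (subst emeasure_distr[OF cis_measurable_circle]) (auto simp: space_restrict_space)
    then show ?thesis
      by (subst (asm) emeasure_restrict_space) (auto simp: Int_commute)
  qed
  show ?thesis
  proof (rule measure_eqI)
    fix A assume "A \<in> sets (distr circle_measure circle_measure ((*) u))"
    then have A: "A \<in> sets ?S" by (simp add: S)
    then have Ab: "A \<in> sets borel"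
      by (subst (asm) sets_restrict_space_iff) auto
    have M': "(\<lambda>\<tau>. u * \<tau>) \<in> measurable circle_measure circle_measure"
      using M S by (simp cong: measurable_cong_sets)
    define B where "B = cis -` A"
    have B[measurable]: "B \<in> sets borel"
      using measurable_sets[OF cm Ab] by (simp add: B_def)
    have per: "x + 2 * pi \<in> B \<longleftrightarrow> x \<in> B" for x
      by (simp add: B_def cis_mult[symmetric])
    have sp: "space circle_measure = sphere 0 1"
      by (simp add: circle_measure_def space_restrict_space)
    have uA: "(\<lambda>\<tau>. u * \<tau>) -` A \<inter> sphere 0 1 \<in> sets ?S"
      using measurable_sets[OF M A] by (simp add: space_restrict_space)
    have "emeasure (distr circle_measure circle_measure ((*) u)) A =
        emeasure circle_measure ((\<lambda>\<tau>. u * \<tau>) -` A \<inter> sphere 0 1)"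
      using A by (subst emeasure_distr[OF M']) (auto simp: S sp)
    also have "\<dots> = emeasure lborel ({0..<2 * pi} \<inter> {x. t + x \<in> B})"
      by (subst em[OF uA], rule arg_cong[where f = "emeasure lborel"])
         (auto simp: B_def t cis_mult)
    also have "{0..<2 * pi} \<inter> {x. t + x \<in> B} = (\<lambda>x. t + x) -` ({t..<t + 2 * pi} \<inter> B) \<inter> space lborel"
      by auto
    also have "emeasure lborel \<dots> = emeasure (distr lborel borel ((+) t)) ({t..<t + 2 * pi} \<inter> B)"
      by (subst emeasure_distr) auto
    also have "\<dots> = emeasure lborel ({t..<t + 2 * pi} \<inter> B)"
      by (simp add: lborel_distr_plus)
    also have "\<dots> = emeasure lborel ({t..<2 * pi} \<inter> B) + emeasure lborel ({2 * pi..<2 * pi + t} \<inter> B)"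
      by (subst plus_emeasure) (use t in \<open>auto intro!: arg_cong[where f = "emeasure lborel"]\<close>)
    also have "emeasure lborel ({2 * pi..<2 * pi + t} \<inter> B) =
        emeasure (distr lborel borel ((+) (2 * pi))) ({2 * pi..<2 * pi + t} \<inter> B)"
      by (simp add: lborel_distr_plus)
    also have "\<dots> = emeasure lborel ({0..<t} \<inter> B)"
      by (subst emeasure_distr)
         (auto intro!: arg_cong[where f = "emeasure lborel"] simp: add.commute[of "2 * pi"] per)
    also have "emeasure lborel ({t..<2 * pi} \<inter> B) + emeasure lborel ({0..<t} \<inter> B) =
        emeasure lborel ({0..<2 * pi} \<inter> B)"
      by (subst plus_emeasure) (use t in \<open>auto intro!: arg_cong[where f = "emeasure lborel"]\<close>)
    also have "\<dots> = emeasure circle_measure A"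
      by (simp add: em[OF A] B_def)
    finally show "emeasure (distr circle_measure circle_measure ((*) u)) A =
        emeasure circle_measure A" .
  qed simp
qed

text \<open>The map in the definition of \<^const>\<open>radial_measure\<close> is measurable, so that \<^const>\<open>distr\<close>
  there is the genuine pushforward.\<close>

lemma radial_map_measurable:
  assumes "sets \<eta> = sets (restrict_space borel {0..<1})"
  shows "(\<lambda>(r, \<tau>). complex_of_real r * \<tau>) \<in>
    measurable (\<eta> \<Otimes>\<^sub>M circle_measure) (restrict_space borel unit_disk)"
proof (rule measurable_restrict_space2)
  have sp: "space \<eta> = {0..<1}" "space circle_measure = sphere 0 1"
    using sets_eq_imp_space_eq[OF assms] by (auto simp: circle_measure_def space_restrict_space)
  show "(\<lambda>(r, \<tau>). complex_of_real r * \<tau>) \<in> space (\<eta> \<Otimes>\<^sub>M circle_measure) \<rightarrow> unit_disk"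
    by (auto simp: space_pair_measure sp norm_mult)
  have "(\<lambda>x. x) \<in> measurable \<eta> borel"
    by (subst measurable_cong_sets[OF assms refl]) (simp add: measurable_restrict_space1)
  moreover have "(\<lambda>x. x) \<in> measurable circle_measure borel"
    by (simp add: circle_measure_def measurable_restrict_space1)
  ultimately show "(\<lambda>(r, \<tau>). complex_of_real r * \<tau>) \<in> borel_measurable (\<eta> \<Otimes>\<^sub>M circle_measure)"
    by measurable
qed

end

theory Submission
  imports Defs
begin

text \<open>
  As \<open>\<mu>\<close> is rotation invariant, \<open>T\<^sub>\<mu>\<close> maps \<open>z\<^sup>k\<close> to \<open>\<gamma>\<^sub>\<eta>(k) z\<^sup>k\<close>, and the monomials are orthogonal on
  every disk about the origin. So \<open>T\<^sub>\<mu>\<close> is the Taylor multiplier with sequence \<open>\<gamma>\<^sub>\<eta>\<close>, which gives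
  \<open>(a) \<longleftrightarrow> (c)\<close>. Expanding \<open>(1 + x) / (1 - x)\<^sup>3 = (\<Sum>k. (k + 1)\<^sup>2 x\<^sup>k)\<close> exhibits \<open>\<beta>\<^sub>\<eta>(a)\<close> as an average of
  \<open>\<gamma>\<^sub>\<eta>\<close> with the weights \<open>(1 - a\<^sup>2)\<^sup>2 (k + 1) a\<^bsup>2k\<^esup>\<close>, so \<open>(c) \<longrightarrow> (b)\<close>; restricting the integral in
  \<open>\<beta>\<^sub>\<eta>(a)\<close> to \<open>[a,1)\<close> gives \<open>\<kappa>\<^sub>\<eta> \<le> 8 \<beta>\<^sub>\<eta>\<close>, so \<open>(b) \<longrightarrow> (d)\<close>; and writing the moments of \<open>\<eta>\<close> as
  integrals of the tails \<open>\<eta>([t,1))\<close> gives \<open>(d) \<longrightarrow> (c)\<close>.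
\<close>

section \<open>Rotation invariant measures\<close>

lemma borel_measurable_cnj [measurable (raw)]:
  assumes "f \<in> borel_measurable M"
  shows "(\<lambda>x. cnj (f x)) \<in> borel_measurable M"
  by (rule measurable_compose[OF assms borel_measurable_continuous_onI])
    (intro continuous_intros)

text \<open>The change of variables theorems of the library concern \<^typ>\<open>real^'n\<close>, so rotations of the
  complex plane are treated in \<^typ>\<open>real^2\<close>.\<close>

lemma lborel_complex_eq_distr:
  "(lborel :: complex measure) = distr lborel borel (\<lambda>v::real^2. Complex (v $ 1) (v $ 2))"
proof (rule lborel_eqI)
  have meas: "(\<lambda>v::real^2. Complex (v $ 1) (v $ 2)) \<in> borel_measurable borel"
    by (intro borel_measurable_continuous_onI continuous_intros)
  show "emeasure (distr lborel borel (\<lambda>v::real^2. Complex (v $ 1) (v $ 2))) (box l u) =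
      (\<Prod>b\<in>Basis. (u - l) \<bullet> b)"
    if le: "\<And>b. b \<in> Basis \<Longrightarrow> l \<bullet> b \<le> u \<bullet> b" for l u :: complex
  proof -
    have "(\<lambda>v::real^2. Complex (v $ 1) (v $ 2)) -` box l u =
        box (vector [Re l, Im l]) (vector [Re u, Im u])"
      by (auto simp: box_def Basis_vec_def Basis_complex_def inner_axis forall_2)
    moreover have *: "\<forall>i. (vector [Re l, Im l] :: real^2) $ i \<le> vector [Re u, Im u] $ i"
      using le[of 1] le[of \<i>] by (simp add: forall_2 Basis_complex_def)
    ultimately have "emeasure (distr lborel borel (\<lambda>v::real^2. Complex (v $ 1) (v $ 2))) (box l u) =
        emeasure lborel (box (vector [Re l, Im l]) (vector [Re u, Im u] :: real^2))"
      using meas by (subst emeasure_distr) auto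
    also have "\<dots> = (\<Prod>b\<in>Basis. (vector [Re u, Im u] - vector [Re l, Im l] :: real^2) \<bullet> b)"
      using * by (intro emeasure_lborel_box) (auto simp: Basis_vec_def inner_axis)
    also have "(\<Prod>b\<in>Basis. (vector [Re u, Im u] - vector [Re l, Im l] :: real^2) \<bullet> b) =
       (\<Prod>b\<in>Basis. (u - l) \<bullet> b)"
      by (auto simp: Basis_vec_def Basis_complex_def inner_axis UNIV_2 axis_eq_axis)
    finally show ?thesis .
  qed
qed simp

text \<open>A pushforward measures boxes through preimages, while orthogonal invariance is available
  for images. As \<open>f\<close> is bijective, the preimage of a box is its image under
  \<open>inv f\<close>, which is orthogonal too; agreement on boxes determines Lebesgue
  measure.\<close>

lemma lborel_distr_orthogonal:
  fixes f :: "real^'n::{finite,wellorder} \<Rightarrow> real^'n::_"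
  assumes f: "orthogonal_transformation f"
  shows "distr lborel borel f = lborel"
proof (rule lborel_eqI[symmetric])
  have meas: "f \<in> borel_measurable borel"
    using orthogonal_transformation_linear[OF f]
    by (intro borel_measurable_continuous_onI linear_continuous_on)
      (simp add: linear_conv_bounded_linear)
  have g: "orthogonal_transformation (inv f)"
    using f by (rule orthogonal_transformation_inv)
  show "emeasure (distr lborel borel f) (box l u) = (\<Prod>b\<in>Basis. (u - l) \<bullet> b)"
    if le: "\<And>b. b \<in> Basis \<Longrightarrow> l \<bullet> b \<le> u \<bullet> b" for l u
  proof -
    have img: "f -` box l u = inv f ` box l u"
      using bij_vimage_eq_inv_image orthogonal_transformation_bij[OF f] by blast
    have m: "inv f ` box l u \<in> lmeasurable"
      using g by (rule measurable_orthogonal_image) simp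
    have "emeasure (distr lborel borel f) (box l u) = emeasure lebesgue (inv f ` box l u)"
      using meas measurable_sets[OF meas, of "box l u"]
      by (subst emeasure_distr) (auto simp: img)
    also have "\<dots> = measure lebesgue (inv f ` box l u)"
      using m by (simp add: emeasure_eq_measure2)
    also have "\<dots> = measure lebesgue (box l u)"
      using g by (simp add: measure_orthogonal_image)
    also have "\<dots> = (\<Prod>b\<in>Basis. (u - l) \<bullet> b)"
      using le by (simp add: measure_lborel_box)
    finally show ?thesis .
  qed
qed simp

text \<open>In Cartesian coordinates multiplication by \<open>u\<close> becomes the linear map
  \<open>?R\<close>. The two-squares identity together with |u| = 1 shows that it preserves norms,
  so the orthogonal case applies.\<close>

lemma lborel_distr_rotation:
  assumes "norm u = 1"
  shows "distr lborel borel (\<lambda>w. u * w) = (lborel :: complex measure)"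
proof -
  let ?c = "\<lambda>v::real^2. Complex (v $ 1) (v $ 2)"
  let ?R = "\<lambda>v::real^2. vector [Re u * v $ 1 - Im u * v $ 2, Re u * v $ 2 + Im u * v $ 1] :: real^2"
  have [measurable]: "?c \<in> borel_measurable borel"
    by (intro borel_measurable_continuous_onI continuous_intros)
  have u: "(Re u)\<^sup>2 + (Im u)\<^sup>2 = 1"
    using assms by (simp add: cmod_def)
  have lin: "linear ?R"
    by (intro linearI) (auto simp: vec_eq_iff forall_2 algebra_simps)
  have "norm (?R v) = norm v" for v
  proof -
    have "(Re u * v $ 1 - Im u * v $ 2)\<^sup>2 + (Re u * v $ 2 + Im u * v $ 1)\<^sup>2 =
        ((Re u)\<^sup>2 + (Im u)\<^sup>2) * ((v $ 1)\<^sup>2 + (v $ 2)\<^sup>2)"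
      by (simp add: power2_eq_square algebra_simps)
    then show ?thesis
      by (simp add: norm_vec_def L2_set_def sum_2 u)
  qed
  then have orth: "orthogonal_transformation ?R"
    using lin by (simp add: orthogonal_transformation)
  have [measurable]: "?R \<in> borel_measurable borel"
    using lin by (intro borel_measurable_continuous_onI linear_continuous_on)
      (simp add: linear_conv_bounded_linear)
  have "distr lborel borel (\<lambda>w. u * w) = distr lborel borel ((\<lambda>w. u * w) \<circ> ?c)"
    by (subst lborel_complex_eq_distr, subst distr_distr) auto
  \<comment> \<open>The coordinate map \<open>?c\<close> intertwines the two rotations, so the
    pushforward can be taken along \<open>?R\<close> first, where invariance is known.\<close>
  also have "(\<lambda>w. u * w) \<circ> ?c = ?c \<circ> ?R"
    by (auto simp: fun_eq_iff complex_eq_iff algebra_simps)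
  also have "distr lborel borel (?c \<circ> ?R) = distr (distr lborel borel ?R) borel ?c"
    by (subst distr_distr) auto
  also have "\<dots> = lborel"
    by (simp add: lborel_distr_orthogonal[OF orth] flip: lborel_complex_eq_distr)
  finally show ?thesis .
qed

text \<open>Captures what arc length on the circle and area on disks about the origin share. The
  bound \<open>R\<close> on the space makes all moments integrable and is the radius at which power
  series are required to converge absolutely.\<close>

locale rotation_invariant_measure = finite_measure M for M :: "complex measure" +
  fixes R :: real
  assumes measurable_ident [measurable]: "(\<lambda>w. w) \<in> borel_measurable M"
    and measurable_rotation: "norm u = 1 \<Longrightarrow> (\<lambda>w. u * w) \<in> measurable M M"
    and distr_rotation: "norm u = 1 \<Longrightarrow> distr M M (\<lambda>w. u * w) = M"
    and space_subset: "space M \<subseteq> cball 0 R"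
    and R_nonneg: "0 \<le> R"
begin

lemma norm_le_R: "w \<in> space M \<Longrightarrow> norm w \<le> R"
  using space_subset by auto

lemma integrable_moment: "integrable M (\<lambda>w. w ^ j * cnj w ^ n)"
proof (rule integrable_const_bound[where B = "R ^ j * R ^ n"])
  show "AE w in M. norm (w ^ j * cnj w ^ n) \<le> R ^ j * R ^ n"
    using norm_le_R R_nonneg
    by (intro AE_I2) (auto simp: norm_mult norm_power intro!: mult_mono power_mono)
qed measurable

lemma moment_eq_0:
  assumes "j \<noteq> n"
  shows "(LINT w|M. w ^ j * cnj w ^ n) = 0"
proof -
  \<comment> \<open>Rotation by the angle \<open>t\<close> multiplies the moment by
    \<open>cis ((real j - real n) * t)\<close> and preserves the measure. This choice makes the
    factor \<open>cis pi\<close>, which is -1, so the moment equals its own negative.\<close>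
  define t where "t = pi / (real j - real n)"
  have "(LINT w|M. w ^ j * cnj w ^ n) = (LINT w|distr M M (\<lambda>w. cis t * w). w ^ j * cnj w ^ n)"
    by (simp add: distr_rotation)
  also have "\<dots> = (LINT w|M. (cis t ^ j * cis (- t) ^ n) * (w ^ j * cnj w ^ n))"
    by (subst integral_distr[OF measurable_rotation])
      (auto simp: power_mult_distrib cis_cnj mult_ac)
  also have "\<dots> = (cis t ^ j * cis (- t) ^ n) * (LINT w|M. w ^ j * cnj w ^ n)"
    by simp
  also have "cis t ^ j * cis (- t) ^ n = cis ((real j - real n) * t)"
    by (simp add: Complex.DeMoivre cis_mult algebra_simps)
  also have "(real j - real n) * t = pi"
    using assms by (simp add: t_def)
  finally show ?thesis
    by simp
qed

text \<open>Parseval's identity for polynomials: the square is expanded as a product with the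
  conjugate, and \<open>moment_eq_0\<close> removes every term off the diagonal. The computation
  runs in the complex numbers and returns to the reals by injectivity of
  \<open>of_real\<close>.\<close>

lemma integral_norm_sum_squared:
  "(LINT w|M. (norm (\<Sum>k<n. a k * w ^ k))\<^sup>2) =
    (\<Sum>k<n. (norm (a k))\<^sup>2 * (LINT w|M. norm w ^ (2 * k)))"
proof -
  have diag: "(LINT w|M. w ^ k * cnj w ^ k) = complex_of_real (LINT w|M. norm w ^ (2 * k))" for k
  proof -
    have "w ^ k * cnj w ^ k = complex_of_real (norm w ^ (2 * k))" for w
      by (metis complex_norm_square of_real_power power_mult power_mult_distrib)
    then show ?thesis
      by (simp only: integral_complex_of_real)
  qed
  have "complex_of_real (LINT w|M. (norm (\<Sum>k<n. a k * w ^ k))\<^sup>2) =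
      (LINT w|M. (\<Sum>k<n. a k * w ^ k) * cnj (\<Sum>k<n. a k * w ^ k))"
    by (simp only: integral_complex_of_real[symmetric] complex_norm_square)
  also have "\<dots> = (LINT w|M. (\<Sum>k<n. \<Sum>j<n. (a k * cnj (a j)) * (w ^ k * cnj w ^ j)))"
    by (simp add: sum_product mult_ac)
  also have "\<dots> = (\<Sum>k<n. \<Sum>j<n. (a k * cnj (a j)) * (LINT w|M. w ^ k * cnj w ^ j))"
    by (subst Bochner_Integration.integral_sum
        | intro sum.cong refl Bochner_Integration.integrable_sum integrable_mult_right
            integrable_moment | simp)+
  also have "\<dots> = (\<Sum>k<n. \<Sum>j<n. if j = k then (a k * cnj (a k)) * (LINT w|M. w ^ k * cnj w ^ k) else 0)"
    by (intro sum.cong refl) (auto simp: moment_eq_0)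
  also have "\<dots> = (\<Sum>k<n. (a k * cnj (a k)) * (LINT w|M. w ^ k * cnj w ^ k))"
    by simp
  also have "\<dots> = complex_of_real (\<Sum>k<n. (norm (a k))\<^sup>2 * (LINT w|M. norm w ^ (2 * k)))"
    by (simp only: diag of_real_sum of_real_mult complex_norm_square)
  finally show ?thesis
    using of_real_eq_iff by blast
qed

text \<open>Dominated convergence: absolute convergence at radius \<open>R\<close> bounds all
  partial sums by one constant on the whole space, and constants are integrable because the measure
  is finite.\<close>

lemma integral_norm_powser_squared_LIMSEQ:
  assumes "summable (\<lambda>k. norm (a k) * R ^ k)"
  shows "(\<lambda>n. LINT w|M. (norm (\<Sum>k<n. a k * w ^ k))\<^sup>2) \<longlonglongrightarrow>
    (LINT w|M. (norm (\<Sum>k. a k * w ^ k))\<^sup>2)"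
proof (rule integral_dominated_convergence[where w = "\<lambda>_. (\<Sum>k. norm (a k) * R ^ k)\<^sup>2"])
  have term_le: "norm (a k * w ^ k) \<le> norm (a k) * R ^ k" if "w \<in> space M" for w k
    using norm_le_R[OF that] by (auto simp: norm_mult norm_power intro!: mult_left_mono power_mono)
  then have sm: "summable (\<lambda>k. a k * w ^ k)" if "w \<in> space M" for w
    using term_le[OF that] by (intro summable_comparison_test'[OF assms, of 0]) auto
  show "AE w in M. (\<lambda>n. (norm (\<Sum>k<n. a k * w ^ k))\<^sup>2) \<longlonglongrightarrow> (norm (\<Sum>k. a k * w ^ k))\<^sup>2"
    by (intro AE_I2 tendsto_intros summable_LIMSEQ sm)
  show "AE w in M. norm ((norm (\<Sum>k<n. a k * w ^ k))\<^sup>2) \<le> (\<Sum>k. norm (a k) * R ^ k)\<^sup>2" for n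
  proof (intro AE_I2)
    fix w assume w: "w \<in> space M"
    have "norm (\<Sum>k<n. a k * w ^ k) \<le> (\<Sum>k<n. norm (a k) * R ^ k)"
      using term_le[OF w] by (rule sum_norm_le)
    also have "\<dots> \<le> (\<Sum>k. norm (a k) * R ^ k)"
      using assms R_nonneg by (intro sum_le_suminf) auto
    finally show "norm ((norm (\<Sum>k<n. a k * w ^ k))\<^sup>2) \<le> (\<Sum>k. norm (a k) * R ^ k)\<^sup>2"
      by (simp add: power_mono)
  qed
qed auto

text \<open>Parseval compares the partial sums coefficient by coefficient; the inequality with the
  factor \<open>C^2\<close> then passes to the limit on both sides.\<close>

lemma integral_multiplier_le:
  assumes a: "summable (\<lambda>k. norm (a k) * R ^ k)"
    and c: "\<And>k. norm (c k) \<le> C"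
  shows "(LINT w|M. (norm (\<Sum>k. c k * a k * w ^ k))\<^sup>2) \<le>
    C\<^sup>2 * (LINT w|M. (norm (\<Sum>k. a k * w ^ k))\<^sup>2)"
proof (rule LIMSEQ_le)
  have "norm (c k * a k) * R ^ k \<le> C * (norm (a k) * R ^ k)" for k
    using mult_right_mono[OF c[of k], of "norm (a k) * R ^ k"] R_nonneg
    by (simp add: norm_mult mult_ac)
  then have "summable (\<lambda>k. norm (c k * a k) * R ^ k)"
    using R_nonneg
    by (intro summable_comparison_test'[OF summable_mult[OF a, of C], of 0]) (auto simp: abs_mult)
  then show "(\<lambda>n. LINT w|M. (norm (\<Sum>k<n. c k * a k * w ^ k))\<^sup>2) \<longlonglongrightarrow>
      (LINT w|M. (norm (\<Sum>k. c k * a k * w ^ k))\<^sup>2)"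
    by (rule integral_norm_powser_squared_LIMSEQ)
  show "(\<lambda>n. C\<^sup>2 * (LINT w|M. (norm (\<Sum>k<n. a k * w ^ k))\<^sup>2)) \<longlonglongrightarrow>
      C\<^sup>2 * (LINT w|M. (norm (\<Sum>k. a k * w ^ k))\<^sup>2)"
    by (intro tendsto_mult tendsto_const integral_norm_powser_squared_LIMSEQ a)
  have "(norm (c k * a k))\<^sup>2 * (LINT w|M. norm w ^ (2 * k)) \<le>
      C\<^sup>2 * ((norm (a k))\<^sup>2 * (LINT w|M. norm w ^ (2 * k)))" for k
  proof -
    have "(norm (c k))\<^sup>2 \<le> C\<^sup>2"
      using c by (intro power_mono) auto
    from mult_right_mono[OF this, of "(norm (a k))\<^sup>2 * (LINT w|M. norm w ^ (2 * k))"] show ?thesis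
      by (simp add: norm_mult power_mult_distrib mult_ac)
  qed
  then show "\<exists>N. \<forall>n\<ge>N. (LINT w|M. (norm (\<Sum>k<n. c k * a k * w ^ k))\<^sup>2) \<le>
      C\<^sup>2 * (LINT w|M. (norm (\<Sum>k<n. a k * w ^ k))\<^sup>2)"
    by (auto simp: integral_norm_sum_squared sum_distrib_left intro!: sum_mono)
qed

end

section \<open>Instances: the circle and disks about the origin\<close>

lemma rotation_invariant_measure_circle: "rotation_invariant_measure circle_measure 1"
proof -
  have sp: "space circle_measure = sphere 0 1"
    by (simp add: circle_measure_def space_restrict_space)
  have st: "sets circle_measure = sets (restrict_space borel (sphere 0 1))"
    by (simp add: circle_measure_def)
  interpret finite_measure circle_measure
    by (rule finite_measureI) (simp add: sp circle_measure_mass)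
  show ?thesis
  proof
    show "(\<lambda>w. w) \<in> borel_measurable circle_measure"
      by (simp add: circle_measure_def measurable_restrict_space1)
    show "(\<lambda>w. u * w) \<in> measurable circle_measure circle_measure" if "norm u = 1" for u
      unfolding measurable_cong_sets[OF st st]
      using that by (intro measurable_restrict_space3) (auto simp: norm_mult)
  qed (auto simp: circle_measure_rotation sp)
qed

lemma rotation_invariant_measure_ball:
  assumes "0 \<le> r"
  shows "rotation_invariant_measure (restrict_space lborel (ball 0 r)) r"
proof -
  let ?M = "restrict_space lborel (ball 0 r) :: complex measure"
  interpret finite_measure ?M
    using emeasure_lborel_ball_finite[of "0 :: complex" r]
    by (intro finite_measureI) (auto simp: space_restrict_space emeasure_restrict_space)
  show ?thesis
  proof
    show "(\<lambda>w. w) \<in> borel_measurable ?M"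
      by (simp add: measurable_restrict_space1)
    show meas: "(\<lambda>w. u * w) \<in> measurable ?M ?M" if "norm u = 1" for u
      using that by (intro measurable_restrict_space3) (auto simp: norm_mult)
    show "distr ?M ?M (\<lambda>w. u * w) = ?M" if u: "norm u = 1" for u
    proof (rule measure_eqI)
      fix A assume "A \<in> sets (distr ?M ?M (\<lambda>w. u * w))"
      then have A: "A \<in> sets ?M" by simp
      then have A': "A \<in> sets borel" "A \<subseteq> ball 0 r"
        by (auto simp: sets_restrict_space_iff)
      \<comment> \<open>A rotation preserves the norm, so the preimage stays inside the ball and the
        restricted measure can be exchanged for Lebesgue measure on the plane.\<close>
      have vim: "(\<lambda>w. u * w) -` A \<subseteq> ball 0 r"
        using A'(2) u by (auto simp: norm_mult dest!: subsetD)
      have "emeasure (distr ?M ?M (\<lambda>w. u * w)) A = emeasure ?M ((\<lambda>w. u * w) -` A)"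
        using A vim by (subst emeasure_distr[OF meas[OF u]])
          (auto simp: space_restrict_space intro!: arg_cong[where f = "emeasure ?M"])
      also have "\<dots> = emeasure lborel ((\<lambda>w. u * w) -` A)"
        using vim by (subst emeasure_restrict_space) auto
      also have "\<dots> = emeasure (distr lborel borel (\<lambda>w. u * w)) A"
        using A' by (subst emeasure_distr) auto
      also have "\<dots> = emeasure ?M A"
        using A' by (simp add: lborel_distr_rotation[OF u] emeasure_restrict_space)
      finally show "emeasure (distr ?M ?M (\<lambda>w. u * w)) A = emeasure ?M A" .
    qed simp
  qed (use assms in \<open>auto simp: space_restrict_space\<close>)
qed

section \<open>Taylor multipliers on the Bergman space\<close>

lemma bergman_norm_nonneg: "0 \<le> bergman_norm f"
  by (simp add: bergman_norm_def set_lebesgue_integral_def)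

lemma bergman_norm_squared: "(bergman_norm f)\<^sup>2 = (LINT z:unit_disk|lborel. (norm (f z))\<^sup>2)"
  by (simp add: bergman_norm_def set_lebesgue_integral_def)

lemma taylor_sums_unit_disk:
  assumes "f holomorphic_on unit_disk" "z \<in> unit_disk"
  shows "(\<lambda>k. fps_nth (fps_expansion f 0) k * z ^ k) sums f z"
  using holomorphic_power_series[OF assms] by (simp add: fps_expansion_def)

lemma taylor_summable_unit_disk:
  assumes f: "f holomorphic_on unit_disk" and r: "0 \<le> r" "r < 1"
  shows "summable (\<lambda>k. norm (fps_nth (fps_expansion f 0) k) * r ^ k)"
proof -
  \<comment> \<open>A radius strictly between \<open>r\<close> and 1: convergence of the Taylor
    series at \<open>s\<close> yields absolute convergence at the smaller radius
    \<open>r\<close>.\<close>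
  define s where "s = (r + 1) / 2"
  have s: "norm (complex_of_real s) = s" "r < s" "s < 1"
    using r by (simp_all only: s_def norm_of_real) auto
  then have "summable (\<lambda>k. fps_nth (fps_expansion f 0) k * complex_of_real s ^ k)"
    using taylor_sums_unit_disk[OF f, of "of_real s"] by (simp add: sums_iff)
  from powser_insidea[OF this, of "of_real r"] show ?thesis
    using r s by (simp add: norm_mult norm_power)
qed

lemma set_integrable_ball:
  fixes g :: "complex \<Rightarrow> complex"
  assumes "g holomorphic_on unit_disk" "r < 1"
  shows "set_integrable lborel (ball 0 r) (\<lambda>z. (norm (g z))\<^sup>2)"
proof -
  have "continuous_on (cball 0 r) (\<lambda>z. (norm (g z))\<^sup>2)"
    using assms by (intro continuous_intros holomorphic_on_imp_continuous_on
        holomorphic_on_subset[OF assms(1)]) auto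
  then have "set_integrable lborel (cball 0 r) (\<lambda>z. (norm (g z))\<^sup>2)"
    unfolding set_integrable_def by (intro borel_integrable_compact) auto
  then show ?thesis
    by (rule set_integrable_subset) auto
qed

text \<open>The diagonal operator taking z^k to c k * z^k; with \<open>gamma_seq\<close> for
  \<open>c\<close> it will be the bounded extension of the Toeplitz operator. The value 0 off the
  disk follows the representation chosen for Bergman functions.\<close>

definition taylor_multiplier :: "(nat \<Rightarrow> complex) \<Rightarrow> (complex \<Rightarrow> complex) \<Rightarrow> complex \<Rightarrow> complex" where
  "taylor_multiplier c f z =
    (if z \<in> unit_disk then \<Sum>k. c k * fps_nth (fps_expansion f 0) k * z ^ k else 0)"

context
  fixes c :: "nat \<Rightarrow> complex" and C :: real
  assumes c: "\<And>k. norm (c k) \<le> C"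
begin

lemma taylor_multiplier_sums:
  assumes f: "f holomorphic_on unit_disk" and z: "z \<in> unit_disk"
  shows "(\<lambda>k. c k * fps_nth (fps_expansion f 0) k * z ^ k) sums taylor_multiplier c f z"
proof -
  have "summable (\<lambda>k. C * (norm (fps_nth (fps_expansion f 0) k) * norm z ^ k))"
    using z by (intro summable_mult taylor_summable_unit_disk f) auto
  then have "summable (\<lambda>k. c k * fps_nth (fps_expansion f 0) k * z ^ k)"
    by (rule summable_comparison_test'[where N = 0])
      (auto simp: norm_mult norm_power mult.assoc intro: mult_right_mono[OF c])
  then show ?thesis
    using z by (simp add: taylor_multiplier_def summable_sums)
qed

lemma taylor_multiplier_holomorphic:
  assumes "f holomorphic_on unit_disk"
  shows "taylor_multiplier c f holomorphic_on unit_disk"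
  using taylor_multiplier_sums[OF assms]
  by (intro power_series_holomorphic[where a = "\<lambda>k. c k * fps_nth (fps_expansion f 0) k"]) auto

text \<open>On a disk of radius \<open>r < 1\<close> the Taylor series converges uniformly, so orthogonality of the monomials
  suffices there; the norms of the monomials do not enter.\<close>

lemma taylor_multiplier_ball_integral_le:
  assumes f: "f \<in> bergman_space" and r: "0 \<le> r" "r < 1"
  shows "(LINT z:ball 0 r|lborel. (norm (taylor_multiplier c f z))\<^sup>2) \<le> (C * bergman_norm f)\<^sup>2"
proof -
  have hol: "f holomorphic_on unit_disk"
    and int: "set_integrable lborel unit_disk (\<lambda>z. (norm (f z))\<^sup>2)"
    using f by (auto simp: bergman_space_def)
  let ?M = "restrict_space lborel (ball 0 r) :: complex measure"
  interpret rotation_invariant_measure ?M r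
    using r(1) by (rule rotation_invariant_measure_ball)
  have eq: "(LINT z:ball 0 r|lborel. (norm (g z))\<^sup>2) = (LINT z|?M. (norm (g z))\<^sup>2)"
    for g :: "complex \<Rightarrow> complex"
    by (simp add: integral_restrict_space set_lebesgue_integral_def)
  have "(LINT z:ball 0 r|lborel. (norm (taylor_multiplier c f z))\<^sup>2) =
      (LINT z|?M. (norm (\<Sum>k. c k * fps_nth (fps_expansion f 0) k * z ^ k))\<^sup>2)"
    unfolding eq using r
    by (intro Bochner_Integration.integral_cong)
      (auto simp: space_restrict_space taylor_multiplier_def)
  also have "\<dots> \<le> C\<^sup>2 * (LINT z|?M. (norm (\<Sum>k. fps_nth (fps_expansion f 0) k * z ^ k))\<^sup>2)"
    by (intro integral_multiplier_le taylor_summable_unit_disk hol r c)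
  also have "(LINT z|?M. (norm (\<Sum>k. fps_nth (fps_expansion f 0) k * z ^ k))\<^sup>2) =
      (LINT z:ball 0 r|lborel. (norm (f z))\<^sup>2)"
    unfolding eq using r sums_unique[OF taylor_sums_unit_disk[OF hol]]
    by (intro Bochner_Integration.integral_cong) (auto simp: space_restrict_space)
  also have "\<dots> \<le> (bergman_norm f)\<^sup>2"
    unfolding bergman_norm_squared set_lebesgue_integral_def
    using r int set_integrable_ball[OF hol r(2)]
    by (intro integral_mono) (auto simp: set_integrable_def split: split_indicator)
  finally show ?thesis
    by (simp add: power_mult_distrib mult_left_mono)
qed

text \<open>The estimate on balls of radius r < 1 is uniform in r. Exhausting the disk by such balls
  gives the same bound for the integral over the disk; integrability there is a consequence, so the
  limit is taken with nonnegative extended integrals.\<close>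

lemma taylor_multiplier_bergman:
  assumes f: "f \<in> bergman_space"
  shows "taylor_multiplier c f \<in> bergman_space"
    and "bergman_norm (taylor_multiplier c f) \<le> C * bergman_norm f"
proof -
  let ?g = "taylor_multiplier c f"
  let ?B = "(C * bergman_norm f)\<^sup>2"
  have hol: "?g holomorphic_on unit_disk"
    using f by (intro taylor_multiplier_holomorphic) (auto simp: bergman_space_def)
  have C: "0 \<le> C"
    using c[of 0] norm_ge_zero[of "c 0"] by linarith
  \<comment> \<open>Continuity is known only on the open disk, but \<open>?g\<close> vanishes
    elsewhere and hence equals its product with the indicator; this makes it Borel on the whole
    plane.\<close>
  have "(\<lambda>z. indicator unit_disk z *\<^sub>R ?g z) \<in> borel_measurable borel"
    using hol by (intro borel_measurable_continuous_on_indicator holomorphic_on_imp_continuous_on) auto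
  also have "(\<lambda>z. indicator unit_disk z *\<^sub>R ?g z) = ?g"
    by (auto simp: fun_eq_iff taylor_multiplier_def indicator_def)
  finally have g_meas [measurable]: "?g \<in> borel_measurable borel" .
  \<comment> \<open>Viewing the squared modulus as the density of a measure turns the exhaustion of
    the disk into continuity of \<open>D\<close> from below.\<close>
  define D where "D = density lborel (\<lambda>z. ennreal ((norm (?g z))\<^sup>2))"
  \<comment> \<open>The shift by 2 makes the radii start at 1/2; they increase to 1 without reaching
    it.\<close>
  define r where "r n = 1 - 1 / real (n + 2)" for n
  have r: "0 \<le> r n" "r n < 1" for n
    by (auto simp: r_def)
  have ball_le: "emeasure D (ball 0 (r n)) \<le> ennreal ?B" for n
  proof -
    have "emeasure D (ball 0 (r n)) = (\<integral>\<^sup>+z. ennreal (indicator (ball 0 (r n)) z *\<^sub>R (norm (?g z))\<^sup>2) \<partial>lborel)"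
      unfolding D_def
      by (subst emeasure_density) (auto intro!: nn_integral_cong split: split_indicator)
    also have "\<dots> = ennreal (LINT z:ball 0 (r n)|lborel. (norm (?g z))\<^sup>2)"
      unfolding set_lebesgue_integral_def using set_integrable_ball[OF hol r(2)]
      by (intro nn_integral_eq_integral) (auto simp: set_integrable_def)
    also have "\<dots> \<le> ennreal ?B"
      by (intro ennreal_leI taylor_multiplier_ball_integral_le f r)
    finally show ?thesis .
  qed
  have UN: "(\<Union>n. ball 0 (r n)) = unit_disk"
  proof (intro equalityI subsetI)
    fix z :: complex assume z: "z \<in> unit_disk"
    have "r \<longlonglongrightarrow> 1 - 0"
      unfolding r_def by (intro tendsto_intros LIMSEQ_ignore_initial_segment lim_1_over_n)
    then have "\<forall>\<^sub>F n in sequentially. norm z < r n"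
      using z by (intro order_tendstoD) auto
    then show "z \<in> (\<Union>n. ball 0 (r n))"
      by (auto dest: eventually_happens)
  next
    fix z :: complex assume "z \<in> (\<Union>n. ball 0 (r n))"
    then obtain n where "norm z < r n" by auto
    also have "r n < 1" by (rule r)
    finally show "z \<in> unit_disk" by simp
  qed
  have "incseq (\<lambda>n. ball (0::complex) (r n))"
    by (intro incseq_SucI subset_ball) (auto simp: r_def field_simps)
  then have "(SUP n. emeasure D (ball 0 (r n))) = emeasure D unit_disk"
    by (subst SUP_emeasure_incseq) (auto simp: D_def UN)
  with ball_le have "emeasure D unit_disk \<le> ennreal ?B"
    by (metis SUP_least)
  also have "emeasure D unit_disk = (\<integral>\<^sup>+z. ennreal (indicator unit_disk z *\<^sub>R (norm (?g z))\<^sup>2) \<partial>lborel)"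
    unfolding D_def
    by (subst emeasure_density) (auto intro!: nn_integral_cong split: split_indicator)
  finally have le: "(\<integral>\<^sup>+z. ennreal (indicator unit_disk z *\<^sub>R (norm (?g z))\<^sup>2) \<partial>lborel) \<le> ennreal ?B" .
  have int: "set_integrable lborel unit_disk (\<lambda>z. (norm (?g z))\<^sup>2)"
    unfolding set_integrable_def
  proof (intro integrableI_bounded)
    have "(\<integral>\<^sup>+z. ennreal (norm (indicator unit_disk z *\<^sub>R (norm (?g z))\<^sup>2)) \<partial>lborel) \<le> ennreal ?B"
      using le by simp
    then show "(\<integral>\<^sup>+z. ennreal (norm (indicator unit_disk z *\<^sub>R (norm (?g z))\<^sup>2)) \<partial>lborel) < \<infinity>"
      by (rule le_less_trans) simp
  qed (intro borel_measurable_scaleR borel_measurable_indicator borel_measurable_power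
      borel_measurable_norm, simp_all add: g_meas)
  show "?g \<in> bergman_space"
    using hol int by (auto simp: bergman_space_def taylor_multiplier_def)
  have "ennreal (LINT z:unit_disk|lborel. (norm (?g z))\<^sup>2) \<le> ennreal ?B"
    using le int unfolding set_lebesgue_integral_def set_integrable_def
    by (subst (asm) nn_integral_eq_integral) auto
  then have "(bergman_norm ?g)\<^sup>2 \<le> ?B"
    by (simp add: bergman_norm_squared)
  then show "bergman_norm ?g \<le> C * bergman_norm f"
    by (rule power2_le_imp_le) (simp add: C bergman_norm_nonneg)
qed

text \<open>Linearity comes from linearity of the derivatives at 0, hence of the Taylor
  coefficients; off the disk both sides vanish.\<close>

lemma bounded_operator_taylor_multiplier: "bergman_bounded_operator (taylor_multiplier c)"
  unfolding bergman_bounded_operator_def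
proof (intro conjI ballI allI)
  show "taylor_multiplier c \<in> bergman_space \<rightarrow> bergman_space"
    using taylor_multiplier_bergman(1) by auto
  show "\<exists>K. \<forall>f\<in>bergman_space. bergman_norm (taylor_multiplier c f) \<le> K * bergman_norm f"
    using taylor_multiplier_bergman(2) by blast
  show "taylor_multiplier c (\<lambda>z. f z + g z) = (\<lambda>z. taylor_multiplier c f z + taylor_multiplier c g z)"
    if fg: "f \<in> bergman_space" "g \<in> bergman_space" for f g
  proof
    fix z
    have hol: "f holomorphic_on unit_disk" "g holomorphic_on unit_disk"
      using fg by (auto simp: bergman_space_def)
    have coeff: "fps_nth (fps_expansion (\<lambda>z. f z + g z) 0) k =
        fps_nth (fps_expansion f 0) k + fps_nth (fps_expansion g 0) k" for k
      using higher_deriv_add[OF hol, of 0 k] by (simp add: fps_expansion_def add_divide_distrib)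
    show "taylor_multiplier c (\<lambda>z. f z + g z) z = taylor_multiplier c f z + taylor_multiplier c g z"
    proof (cases "z \<in> unit_disk")
      case True
      have "(\<lambda>k. c k * fps_nth (fps_expansion (\<lambda>z. f z + g z) 0) k * z ^ k) sums
          (taylor_multiplier c f z + taylor_multiplier c g z)"
        using sums_add[OF taylor_multiplier_sums[OF hol(1) True] taylor_multiplier_sums[OF hol(2) True]]
        by (simp add: coeff algebra_simps)
      then show ?thesis
        using True by (simp add: taylor_multiplier_def sums_iff)
    qed (simp add: taylor_multiplier_def)
  qed
  show "taylor_multiplier c (\<lambda>z. b * f z) = (\<lambda>z. b * taylor_multiplier c f z)"
    if f: "f \<in> bergman_space" for b f
  proof
    fix z
    have hol: "f holomorphic_on unit_disk"
      using f by (auto simp: bergman_space_def)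
    have coeff: "fps_nth (fps_expansion (\<lambda>z. b * f z) 0) k = b * fps_nth (fps_expansion f 0) k" for k
      using higher_deriv_cmult[OF hol, of 0 k b] by (simp add: fps_expansion_def)
    show "taylor_multiplier c (\<lambda>z. b * f z) z = b * taylor_multiplier c f z"
    proof (cases "z \<in> unit_disk")
      case True
      have "(\<lambda>k. c k * fps_nth (fps_expansion (\<lambda>z. b * f z) 0) k * z ^ k) sums
          (b * taylor_multiplier c f z)"
        using sums_mult[OF taylor_multiplier_sums[OF hol True], of b]
        by (simp add: coeff algebra_simps)
      then show ?thesis
        using True by (simp add: taylor_multiplier_def sums_iff)
    qed (simp add: taylor_multiplier_def)
  qed
qed

end

lemma taylor_multiplier_disk_poly:
  assumes "z \<in> unit_disk"
  shows "taylor_multiplier c (disk_poly p) z = (\<Sum>k\<le>degree p. c k * coeff p k * z ^ k)"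
proof -
  have "poly p has_fps_expansion fps_of_poly p"
    by (auto simp: has_fps_expansion_def)
  moreover have "\<forall>\<^sub>F z in nhds 0. poly p z = disk_poly p z"
    using eventually_nhds_in_open[of unit_disk 0] by (auto elim!: eventually_mono simp: disk_poly_def)
  \<comment> \<open>A power series expansion depends only on values near 0, where the cut-off in
    \<open>disk_poly\<close> is invisible.\<close>
  ultimately have "disk_poly p has_fps_expansion fps_of_poly p"
    using has_fps_expansion_cong by blast
  then have "fps_expansion (disk_poly p) 0 = fps_of_poly p"
    by (rule fps_expansion_eqI)
  then have "taylor_multiplier c (disk_poly p) z = (\<Sum>k. c k * coeff p k * z ^ k)"
    using assms by (simp add: taylor_multiplier_def)
  also have "\<dots> = (\<Sum>k\<le>degree p. c k * coeff p k * z ^ k)"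
    by (rule suminf_finite) (auto simp: coeff_eq_0)
  finally show ?thesis .
qed

section \<open>Radial measures\<close>

text \<open>Differentiating the series of (n + 1) x^n gives the sum 2 / (1 - x)^3 with coefficients
  (n + 1)(n + 2). Subtracting the original series leaves (n + 1)^2, since (n + 1)(n + 2) - (n + 1) =
  (n + 1)^2.\<close>

lemma sums_Suc_squared_powser:
  fixes x :: real
  assumes "\<bar>x\<bar> < 1"
  shows "(\<lambda>k. (real k + 1)\<^sup>2 * x ^ k) sums ((1 + x) / (1 - x) ^ 3)"
proof -
  have "(\<lambda>n. diffs (\<lambda>n. real (Suc n)) n * x ^ n) sums (2 / (1 - x) ^ 3)"
  proof (rule termdiffs_sums_strong)
    show "(\<lambda>n. real (Suc n) * z ^ n) sums (1 / (1 - z)\<^sup>2)" if "norm z < 1" for z :: real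
      using geometric_deriv_sums[OF that] by simp
    show "((\<lambda>z. 1 / (1 - z)\<^sup>2) has_field_derivative 2 / (1 - x) ^ 3) (at x)"
    proof -
      have "((\<lambda>z. 1 / (1 - z)\<^sup>2) has_field_derivative
          (0 * (1 - x)\<^sup>2 - 1 * (2 * (1 - x) * (0 - 1))) / ((1 - x)\<^sup>2 * (1 - x)\<^sup>2)) (at x)"
        using assms by (auto intro!: derivative_eq_intros)
      also have "(0 * (1 - x)\<^sup>2 - 1 * (2 * (1 - x) * (0 - 1))) / ((1 - x)\<^sup>2 * (1 - x)\<^sup>2) =
          (2 * (1 - x)) / ((1 - x) ^ 3 * (1 - x))"
        by (simp add: power2_eq_square power3_eq_cube algebra_simps)
      also have "\<dots> = 2 / (1 - x) ^ 3"
        using assms by (subst nonzero_mult_divide_mult_cancel_right) auto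
      finally show ?thesis .
    qed
  qed (use assms in auto)
  from sums_diff[OF this geometric_deriv_sums[of x]]
  have "(\<lambda>k. (real k + 1)\<^sup>2 * x ^ k) sums (2 / (1 - x) ^ 3 - 1 / (1 - x)\<^sup>2)"
    using assms by (simp add: diffs_def power2_eq_square algebra_simps)
  also have "2 / (1 - x) ^ 3 - 1 / (1 - x)\<^sup>2 = (1 + x) / (1 - x) ^ 3"
    using assms by (simp add: divide_simps power2_eq_square power3_eq_cube)
  finally show ?thesis .
qed

lemma norm_poly_le:
  fixes w :: complex
  assumes "norm w \<le> 1"
  shows "norm (poly p w) \<le> (\<Sum>k\<le>degree p. norm (coeff p k))"
  unfolding poly_altdef
  using assms by (intro sum_norm_le) (simp add: norm_mult norm_power power_le_one mult_left_le)

section \<open>Moments of a measure on \<open>[0,1)\<close> and of its rotation to the disk\<close>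

locale unit_interval_measure = finite_measure \<eta> for \<eta> :: "real measure" +
  assumes sets_eq: "sets \<eta> = sets (restrict_space borel {0..<1})"
begin

lemma space_eq: "space \<eta> = {0..<1}"
  using sets_eq_imp_space_eq[OF sets_eq] by (simp add: space_restrict_space)

lemma measurable_ident_borel [measurable]: "(\<lambda>r. r) \<in> borel_measurable \<eta>"
  by (subst measurable_cong_sets[OF sets_eq refl]) (simp add: measurable_restrict_space1)

lemma atLeast_in_sets [measurable]: "0 \<le> a \<Longrightarrow> {a..<1} \<in> sets \<eta>"
  by (auto simp: sets_eq sets_restrict_space_iff)

lemma integrable_power: "integrable \<eta> (\<lambda>r. r ^ n)"
  by (rule integrable_const_bound[where B = 1])
    (auto simp: space_eq power_le_one intro!: AE_I2)

lemma gamma_seq_nonneg: "0 \<le> gamma_seq \<eta> k"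
  by (simp add: gamma_seq_def)

lemma finite_measure_radial: "finite_measure (radial_measure \<eta>)"
proof -
  interpret circle: rotation_invariant_measure circle_measure 1
    by (rule rotation_invariant_measure_circle)
  interpret P: finite_measure "\<eta> \<Otimes>\<^sub>M circle_measure"
    by (intro finite_measure_pair_measure) unfold_locales
  show ?thesis
    unfolding radial_measure_def
    by (intro P.finite_measure_distr radial_map_measurable sets_eq)
qed

lemma measurable_radial: "f \<in> borel_measurable borel \<Longrightarrow> f \<in> borel_measurable (radial_measure \<eta>)"
  by (simp add: radial_measure_def measurable_restrict_space1)

lemma space_radial: "space (radial_measure \<eta>) = unit_disk"
  by (simp add: radial_measure_def space_restrict_space)

text \<open>In polar coordinates the integrand splits into r^(k + n) and a moment of the circle. By
  Fubini the circle factor vanishes off the diagonal, and on the diagonal it is the total mass 2 pi,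
  because the integrand is 1 on the circle.\<close>

lemma radial_moment:
  "(LINT w|radial_measure \<eta>. w ^ k * cnj w ^ n) =
    (if k = n then of_real (2 * pi * (LINT r|\<eta>. r ^ (2 * k))) else 0)"
proof -
  interpret circle: rotation_invariant_measure circle_measure 1
    by (rule rotation_invariant_measure_circle)
  interpret P: finite_measure "\<eta> \<Otimes>\<^sub>M circle_measure"
    by (intro finite_measure_pair_measure) unfold_locales
  interpret pair_sigma_finite \<eta> circle_measure ..
  have sp: "space circle_measure = sphere 0 1"
    by (simp add: circle_measure_def space_restrict_space)
  let ?f = "\<lambda>(r, \<tau>). (of_real r * \<tau>) ^ k * cnj (of_real r * \<tau>) ^ n :: complex"
  have "integrable (\<eta> \<Otimes>\<^sub>M circle_measure) ?f"
  proof (rule P.integrable_const_bound[where B = 1])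
    show "AE x in \<eta> \<Otimes>\<^sub>M circle_measure. norm (?f x) \<le> 1"
      by (intro AE_I2) (auto simp: space_pair_measure sp space_eq norm_mult norm_power
          intro!: mult_le_one power_le_one)
  qed measurable
  from integral_fst'[OF this]
  have "(LINT w|radial_measure \<eta>. w ^ k * cnj w ^ n) =
      (LINT r|\<eta>. LINT \<tau>|circle_measure. of_real (r ^ (k + n)) * (\<tau> ^ k * cnj \<tau> ^ n))"
    unfolding radial_measure_def
    by (subst integral_distr[OF radial_map_measurable[OF sets_eq]])
      (auto simp: case_prod_beta' power_mult_distrib power_add mult_ac measurable_restrict_space1)
  also have "\<dots> = of_real (LINT r|\<eta>. r ^ (k + n)) * (LINT \<tau>|circle_measure. \<tau> ^ k * cnj \<tau> ^ n)"
    by (simp del: of_real_power)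
  also have "\<dots> = (if k = n then of_real (2 * pi * (LINT r|\<eta>. r ^ (2 * k))) else 0)"
  proof (cases "k = n")
    case True
    have "(LINT \<tau>|circle_measure. \<tau> ^ k * cnj \<tau> ^ k) = (LINT \<tau>|circle_measure. (1 :: complex))"
      by (intro Bochner_Integration.integral_cong refl)
        (auto simp: sp complex_norm_square[symmetric] simp flip: power_mult_distrib)
    also have "\<dots> = of_real (2 * pi)"
      using circle_measure_mass by (simp add: sp measure_def scaleR_conv_of_real)
    finally have circle: "(LINT \<tau>|circle_measure. \<tau> ^ k * cnj \<tau> ^ k) = complex_of_real (2 * pi)" .
    show ?thesis
      unfolding True[symmetric]
      by (simp only: circle if_True simp_thms of_real_mult mult.commute mult_2[symmetric])
  qed (simp add: circle.moment_eq_0)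
  finally show ?thesis .
qed

text \<open>The kernel is the series of (n + 1) (z * cnj w)^n. Integrated term by term against the
  polynomial, its n-th term selects the n-th coefficient by \<open>radial_moment\<close>, and (n +
  1) * 2 pi times the radial moment, divided by pi, is \<open>gamma_seq \<eta> n\<close>.\<close>

lemma toeplitz_disk_poly:
  assumes z: "z \<in> unit_disk"
  shows "toeplitz (radial_measure \<eta>) (disk_poly p) z =
    (\<Sum>k\<le>degree p. of_real (gamma_seq \<eta> k) * coeff p k * z ^ k)"
proof -
  let ?\<mu> = "radial_measure \<eta>"
  interpret \<mu>: finite_measure ?\<mu>
    by (rule finite_measure_radial)
  define B where "B = (\<Sum>k\<le>degree p. norm (coeff p k))"
  \<comment> \<open>The n-th term of the expanded integrand. Writing \<open>poly p\<close> for
    \<open>disk_poly p\<close> makes it continuous on the plane, hence measurable; the two agree on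
    the disk.\<close>
  define F where "F n w = of_nat (Suc n) * z ^ n * (poly p w * cnj w ^ n)" for n w
  have F_meas: "F n \<in> borel_measurable ?\<mu>" for n
    unfolding F_def
    by (intro measurable_radial borel_measurable_continuous_onI continuous_intros)
  have F_le: "norm (F n w) \<le> real (Suc n) * norm z ^ n * B" if w: "w \<in> unit_disk" for n w
  proof -
    have "norm (poly p w * cnj w ^ n) \<le> B * 1"
      unfolding norm_mult B_def using w
      by (intro mult_mono norm_poly_le) (auto simp: norm_power power_le_one intro!: sum_nonneg)
    then show ?thesis
      by (simp add: F_def norm_mult norm_power mult_left_mono del: of_nat_Suc)
  qed
  have F_int: "integrable ?\<mu> (F n)" for n
    using F_le F_meas
    by (intro \<mu>.integrable_const_bound[where B = "real (Suc n) * norm z ^ n * B"])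
      (auto simp: space_radial intro!: AE_I2)
  have bound_summable: "summable (\<lambda>n. real (Suc n) * norm z ^ n)"
    using geometric_deriv_sums[of "norm z"] z by (simp add: sums_iff)
  have F_sums: "(\<lambda>n. F n w) sums (disk_poly p w / (1 - z * cnj w)\<^sup>2)" if w: "w \<in> unit_disk" for w
  proof -
    have "norm (z * cnj w) < 1"
      using w z by (simp add: norm_mult) (metis mult_strict_mono' mult_1 norm_ge_zero)
    from sums_mult[OF geometric_deriv_sums[OF this], of "poly p w"] show ?thesis
      using w by (simp add: F_def disk_poly_def power_mult_distrib mult_ac)
  qed
  have F_integral: "(LINT w|?\<mu>. F n w) = of_real pi * (of_real (gamma_seq \<eta> n) * coeff p n * z ^ n)" for n
  proof -
    have int: "integrable ?\<mu> (\<lambda>w. w ^ k * cnj w ^ n)" for k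
    proof (rule \<mu>.integrable_const_bound[where B = 1])
      show "AE w in ?\<mu>. norm (w ^ k * cnj w ^ n) \<le> 1"
        by (intro AE_I2) (auto simp: space_radial norm_mult norm_power intro!: mult_le_one power_le_one)
      show "(\<lambda>w. w ^ k * cnj w ^ n) \<in> borel_measurable ?\<mu>"
        by (intro measurable_radial) measurable
    qed
    have "(LINT w|?\<mu>. F n w) =
        (LINT w|?\<mu>. (\<Sum>k\<le>degree p. of_nat (Suc n) * z ^ n * coeff p k * (w ^ k * cnj w ^ n)))"
      by (simp add: F_def poly_altdef sum_distrib_left sum_distrib_right mult_ac del: of_nat_Suc)
    also have "\<dots> = (\<Sum>k\<le>degree p. of_nat (Suc n) * z ^ n * coeff p k * (LINT w|?\<mu>. w ^ k * cnj w ^ n))"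
      by (subst Bochner_Integration.integral_sum) (auto simp: int simp del: of_nat_Suc)
    also have "\<dots> = (\<Sum>k\<le>degree p. if k = n then of_nat (Suc n) * z ^ n * coeff p n *
        of_real (2 * pi * (LINT r|\<eta>. r ^ (2 * n))) else 0)"
      by (intro sum.cong refl) (simp add: radial_moment)
    \<comment> \<open>For \<open>n\<close> above the degree the sum has no diagonal term, which
      matches \<open>coeff p n = 0\<close> on the right.\<close>
    also have "\<dots> = of_real pi * (of_real (gamma_seq \<eta> n) * coeff p n * z ^ n)"
      by (auto simp: gamma_seq_def coeff_eq_0 mult_ac)
    finally show ?thesis .
  qed
  \<comment> \<open>Sum and integral may be exchanged: the bound (n + 1) |z|^n B is independent of
    \<open>w\<close>, summable in \<open>n\<close>, and the measure is finite.\<close>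
  have "(\<lambda>n. LINT w|?\<mu>. F n w) sums (LINT w|?\<mu>. (\<Sum>n. F n w))"
  proof (rule sums_integral[OF F_int])
    show "AE w in ?\<mu>. summable (\<lambda>n. norm (F n w))"
    proof (rule AE_I2)
      fix w assume "w \<in> space ?\<mu>"
      then have "norm (norm (F n w)) \<le> real (Suc n) * norm z ^ n * B" for n
        using F_le by (simp add: space_radial del: of_nat_Suc)
      then show "summable (\<lambda>n. norm (F n w))"
        by (rule summable_comparison_test'[OF summable_mult2[OF bound_summable]])
    qed
    show "summable (\<lambda>n. LINT w|?\<mu>. norm (F n w))"
    proof (rule summable_comparison_test'[where N = 0])
      show "summable (\<lambda>n. real (Suc n) * norm z ^ n * (B * measure ?\<mu> unit_disk))"
        by (intro summable_mult2 bound_summable)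
      have "(LINT w|?\<mu>. norm (F n w)) \<le> (LINT w|?\<mu>. real (Suc n) * norm z ^ n * B)" for n
        using F_le F_int by (intro integral_mono) (auto simp: space_radial)
      then show "norm (LINT w|?\<mu>. norm (F n w)) \<le> real (Suc n) * norm z ^ n * (B * measure ?\<mu> unit_disk)" for n
        by (simp add: space_radial mult_ac)
    qed
  qed
  moreover have "(LINT w|?\<mu>. (\<Sum>n. F n w)) = (LINT w|?\<mu>. disk_poly p w / (1 - z * cnj w)\<^sup>2)"
    using sums_unique[OF F_sums] by (intro Bochner_Integration.integral_cong) (auto simp: space_radial)
  ultimately have "(\<lambda>n. of_real pi * (of_real (gamma_seq \<eta> n) * coeff p n * z ^ n)) sums
      (LINT w|?\<mu>. disk_poly p w / (1 - z * cnj w)\<^sup>2)"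
    by (simp add: F_integral)
  from sums_mult[OF this, of "1 / of_real pi"]
  have "(\<lambda>n. of_real (gamma_seq \<eta> n) * coeff p n * z ^ n) sums toeplitz ?\<mu> (disk_poly p) z"
    by (simp add: toeplitz_def)
  then have "toeplitz ?\<mu> (disk_poly p) z =
      (\<Sum>n. of_real (gamma_seq \<eta> n) * coeff p n * z ^ n)"
    by (rule sums_unique)
  also have "\<dots> = (\<Sum>k\<le>degree p. of_real (gamma_seq \<eta> k) * coeff p k * z ^ k)"
    by (rule suminf_finite) (auto simp: coeff_eq_0)
  finally show ?thesis .
qed

end

section \<open>The boundedness criteria\<close>

lemma disk_poly_monom_bergman: "disk_poly (monom 1 k) \<in> bergman_space"
proof -
  have "poly (monom 1 k) holomorphic_on unit_disk"
    by (intro holomorphic_intros)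
  then have hol: "disk_poly (monom 1 k) holomorphic_on unit_disk"
    by (rule holomorphic_transform) (simp add: disk_poly_def)
  have "set_integrable lborel (cball 0 1) (\<lambda>z. (norm (poly (monom 1 k) z :: complex))\<^sup>2)"
    unfolding set_integrable_def
    by (intro borel_integrable_compact continuous_intros) auto
  then have "set_integrable lborel unit_disk (\<lambda>z. (norm (poly (monom 1 k) z :: complex))\<^sup>2)"
    by (rule set_integrable_subset) auto
  also have "?this \<longleftrightarrow> set_integrable lborel unit_disk (\<lambda>z. (norm (disk_poly (monom 1 k) z))\<^sup>2)"
    by (intro set_integrable_cong) (auto simp: disk_poly_def)
  finally show ?thesis
    using hol by (auto simp: bergman_space_def disk_poly_def)
qed

text \<open>Allows this norm to be cancelled when an operator acts on the monomial as a scalar. On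
  the annulus 1/2 < |z| < 1 the monomial has modulus at least (1/2)^k, and the annulus, being open
  and containing 3/4, has positive measure.\<close>

lemma bergman_norm_monom_pos: "0 < bergman_norm (disk_poly (monom 1 k))"
proof -
  define f where "f = disk_poly (monom 1 k)"
  define A :: "complex set" where "A = ball 0 1 - cball 0 (1 / 2)"
  have int: "set_integrable lborel unit_disk (\<lambda>z. (norm (f z))\<^sup>2)"
    using disk_poly_monom_bergman[of k] by (simp add: bergman_space_def f_def)
  have "3 / 4 \<in> A"
    by (simp add: A_def)
  moreover have "open A"
    by (simp add: A_def open_Diff)
  ultimately have "A \<notin> null_sets lborel"
    using open_not_negligible[of A]
    by (auto simp: negligible_iff_null_sets dest: null_sets_completionI)
  moreover have "A \<in> sets lborel" using \<open>open A\<close> by simp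
  have fin: "emeasure lborel A < \<infinity>"
    by (rule le_less_trans[OF emeasure_mono emeasure_lborel_ball_finite[of 0 1]]) (auto simp: A_def)
  ultimately have pos: "0 < measure lborel A"
    using \<open>A \<in> sets lborel\<close>
    by (simp add: measure_def enn2real_positive_iff zero_less_iff_neq_zero null_sets_def)
  have "(1 / 2) ^ (2 * k) * measure lborel A = (LINT z:A|lborel. (1 / 2 :: real) ^ (2 * k))"
    using fin \<open>A \<in> sets lborel\<close> by (simp add: set_integral_const)
  also have "\<dots> \<le> (LINT z:unit_disk|lborel. (norm (f z))\<^sup>2)"
    unfolding set_lebesgue_integral_def
  proof (rule integral_mono)
    show "integrable lborel (\<lambda>z. indicat_real A z *\<^sub>R (1 / 2 :: real) ^ (2 * k))"
      using fin \<open>A \<in> sets lborel\<close> by (intro integrable_scaleR_left) simp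
    show "integrable lborel (\<lambda>z. indicat_real unit_disk z *\<^sub>R (norm (f z))\<^sup>2)"
      using int by (simp add: set_integrable_def)
    fix z :: complex
    have "(1 / 2) ^ (2 * k) \<le> (norm (f z))\<^sup>2" if "z \<in> A"
    proof -
      have "(1 / 2) ^ (2 * k) \<le> norm z ^ (2 * k)"
        using that by (intro power_mono) (auto simp: A_def)
      also have "\<dots> = (norm (f z))\<^sup>2"
        using that by (simp add: f_def A_def disk_poly_def poly_monom norm_power power_mult power2_eq_square
            power_mult_distrib)
      finally show ?thesis .
    qed
    then show "indicat_real A z *\<^sub>R (1 / 2) ^ (2 * k) \<le> indicat_real unit_disk z *\<^sub>R (norm (f z))\<^sup>2"
      by (auto simp: A_def split: split_indicator)
  qed
  finally have "0 < (LINT z:unit_disk|lborel. (norm (f z))\<^sup>2)"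
    using pos by (smt (verit, best) mult_pos_pos zero_less_power divide_pos_pos)
  then show ?thesis
    by (simp add: bergman_norm_def f_def)
qed

lemma bergman_norm_cmult: "bergman_norm (\<lambda>z. c * f z) = norm c * bergman_norm f"
  by (simp add: bergman_norm_def norm_mult power_mult_distrib real_sqrt_mult)

lemma bounded_image_real_le:
  fixes f :: "'a \<Rightarrow> real"
  assumes "bounded (f ` A)"
  obtains C where "\<And>x. x \<in> A \<Longrightarrow> f x \<le> C"
proof -
  obtain C where "\<And>y. y \<in> f ` A \<Longrightarrow> norm y \<le> C"
    using assms by (auto simp: bounded_iff)
  then have "f x \<le> C" if "x \<in> A" for x
    using that by (force simp: abs_le_iff)
  then show thesis
    by (rule that)
qed

section \<open>Toeplitz boundedness and \<open>gamma_seq\<close>\<close>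

context unit_interval_measure
begin

text \<open>Monomials are eigenvectors of the extension with eigenvalues
  \<open>gamma_seq \<eta> k\<close>, so any operator bound dominates every term of the
  sequence.\<close>

lemma toeplitz_bounded_imp_gamma_bounded:
  assumes "toeplitz_bounded (radial_measure \<eta>)"
  shows "bounded (range (gamma_seq \<eta>))"
proof -
  obtain T C where T: "T \<in> bergman_space \<rightarrow> bergman_space"
    and C: "\<And>f. f \<in> bergman_space \<Longrightarrow> bergman_norm (T f) \<le> C * bergman_norm f"
    and ext: "\<And>p z. z \<in> unit_disk \<Longrightarrow> T (disk_poly p) z = toeplitz (radial_measure \<eta>) (disk_poly p) z"
    using assms unfolding toeplitz_bounded_def bergman_bounded_operator_def by blast
  have "gamma_seq \<eta> k \<le> C" for k
  proof -
    let ?e = "disk_poly (monom 1 k)"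
    have e: "?e \<in> bergman_space"
      by (rule disk_poly_monom_bergman)
    have "T ?e z = of_real (gamma_seq \<eta> k) * ?e z" for z
    proof (cases "z \<in> unit_disk")
      case True
      have "(\<Sum>n\<le>k. complex_of_real (gamma_seq \<eta> n) * coeff (monom 1 k) n * z ^ n) =
          (\<Sum>n\<le>k. if n = k then of_real (gamma_seq \<eta> k) * z ^ k else 0)"
        by (intro sum.cong) auto
      then show ?thesis
        using True by (simp add: ext toeplitz_disk_poly degree_monom_eq disk_poly_def poly_monom)
    next
      \<comment> \<open>The Toeplitz formula describes \<open>T\<close> only on the disk; elsewhere
        both sides vanish because \<open>T\<close> maps into \<open>bergman_space\<close>.\<close>
      case False
      moreover have "T ?e \<in> bergman_space"
        using T e by auto
      ultimately show ?thesis
        by (auto simp: bergman_space_def disk_poly_def)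
    qed
    then have "T ?e = (\<lambda>z. of_real (gamma_seq \<eta> k) * ?e z)"
      by (rule HOL.ext)
    then have "gamma_seq \<eta> k * bergman_norm ?e \<le> C * bergman_norm ?e"
      using C[OF e] gamma_seq_nonneg[of k] by (simp add: bergman_norm_cmult)
    then show ?thesis
      using bergman_norm_monom_pos[of k] by simp
  qed
  then show ?thesis
    using gamma_seq_nonneg by (intro boundedI[where B = C]) auto
qed

text \<open>The Taylor multiplier with sequence \<open>gamma_seq \<eta>\<close> is the extension: on
  polynomials it and the Toeplitz operator give the same finite sum.\<close>

lemma gamma_bounded_imp_toeplitz_bounded:
  assumes "bounded (range (gamma_seq \<eta>))"
  shows "toeplitz_bounded (radial_measure \<eta>)"
proof -
  obtain C where "\<And>k. norm (complex_of_real (gamma_seq \<eta> k)) \<le> C"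
    using assms by (auto simp: bounded_iff)
  then have "bergman_bounded_operator (taylor_multiplier (\<lambda>k. of_real (gamma_seq \<eta> k)))"
    by (rule bounded_operator_taylor_multiplier)
  then show ?thesis
    unfolding toeplitz_bounded_def
    by (intro exI[of _ "taylor_multiplier (\<lambda>k. of_real (gamma_seq \<eta> k))"])
      (simp add: taylor_multiplier_disk_poly toeplitz_disk_poly)
qed

section \<open>From \<open>gamma_seq\<close> to \<open>beta_fun\<close>\<close>

lemma beta_integrand_bounds:
  fixes a r :: real
  assumes a: "0 \<le> a" "a < 1" and r: "r \<in> {0..<1}"
  shows "0 \<le> a\<^sup>2 * r\<^sup>2" "a\<^sup>2 * r\<^sup>2 \<le> a\<^sup>2" "a\<^sup>2 < 1"
proof -
  have "r\<^sup>2 \<le> 1"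
    using r power_le_one[of r 2] by auto
  from mult_left_mono[OF this, of "a\<^sup>2"] show "a\<^sup>2 * r\<^sup>2 \<le> a\<^sup>2"
    by simp
  show "a\<^sup>2 < 1"
    using a by (simp add: abs_square_less_1)
qed simp

lemma integrable_beta_integrand:
  assumes a: "0 \<le> a" "a < 1"
  shows "integrable \<eta> (\<lambda>r. (1 + a\<^sup>2 * r\<^sup>2) / (1 - a\<^sup>2 * r\<^sup>2) ^ 3)"
\<comment> \<open>The numerator is at most 2, and the base of the denominator is at least 1 - a^2 >
  0 for every r in \<open>[0,1)\<close>.\<close>
proof (rule integrable_const_bound[where B = "2 / (1 - a\<^sup>2) ^ 3"])
  show "AE r in \<eta>. norm ((1 + a\<^sup>2 * r\<^sup>2) / (1 - a\<^sup>2 * r\<^sup>2) ^ 3) \<le> 2 / (1 - a\<^sup>2) ^ 3"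
  proof (rule AE_I2)
    fix r assume "r \<in> space \<eta>"
    then have "0 \<le> a\<^sup>2 * r\<^sup>2" "a\<^sup>2 * r\<^sup>2 \<le> a\<^sup>2" "a\<^sup>2 < 1"
      using beta_integrand_bounds[OF a] by (auto simp: space_eq)
    then have "(1 + a\<^sup>2 * r\<^sup>2) / (1 - a\<^sup>2 * r\<^sup>2) ^ 3 \<le> 2 / (1 - a\<^sup>2) ^ 3"
      and "0 \<le> (1 + a\<^sup>2 * r\<^sup>2) / (1 - a\<^sup>2 * r\<^sup>2) ^ 3"
      by (auto intro!: frac_le power_mono)
    then show "norm ((1 + a\<^sup>2 * r\<^sup>2) / (1 - a\<^sup>2 * r\<^sup>2) ^ 3) \<le> 2 / (1 - a\<^sup>2) ^ 3"
      by simp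
  qed
qed measurable

lemma beta_fun_nonneg:
  assumes a: "0 \<le> a" "a < 1"
  shows "0 \<le> beta_fun \<eta> a"
proof -
  have "0 \<le> (LINT r|\<eta>. (1 + a\<^sup>2 * r\<^sup>2) / (1 - a\<^sup>2 * r\<^sup>2) ^ 3)"
    using beta_integrand_bounds[OF a]
    by (intro Bochner_Integration.integral_nonneg) (fastforce simp: space_eq intro!: divide_nonneg_nonneg)
  then show ?thesis
    by (simp add: beta_fun_def)
qed

lemma gamma_bounded_imp_beta_bounded:
  assumes "bounded (range (gamma_seq \<eta>))"
  shows "bounded (beta_fun \<eta> ` {0..<1})"
proof -
  obtain C where C: "\<And>k. gamma_seq \<eta> k \<le> C"
    using assms by (auto simp: bounded_iff abs_le_iff)
  have "beta_fun \<eta> a \<le> C" if a: "0 \<le> a" "a < 1" for a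
  proof -
    have a2: "0 \<le> a\<^sup>2" "a\<^sup>2 < 1"
      using beta_integrand_bounds[OF a, of 0] by auto
    define f where "f k r = (real k + 1)\<^sup>2 * (a\<^sup>2 * r\<^sup>2) ^ k" for k r
    have f_le: "0 \<le> f k r" "f k r \<le> (real k + 1)\<^sup>2 * (a\<^sup>2) ^ k" if "r \<in> {0..<1}" for k r
      using beta_integrand_bounds[OF a that] by (auto simp: f_def intro!: mult_left_mono power_mono)
    have f_eq: "f k = (\<lambda>r. (real k + 1)\<^sup>2 * (a\<^sup>2) ^ k * r ^ (2 * k))" for k
      by (simp add: f_def fun_eq_iff power_mult_distrib power_mult)
    have f_int: "integrable \<eta> (f k)" for k
      unfolding f_eq by (intro integrable_mult_right integrable_power)
    have f_sums: "(\<lambda>k. f k r) sums ((1 + a\<^sup>2 * r\<^sup>2) / (1 - a\<^sup>2 * r\<^sup>2) ^ 3)" if "r \<in> {0..<1}" for r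
      unfolding f_def using beta_integrand_bounds[OF a that]
      by (intro sums_Suc_squared_powser) linarith
    \<comment> \<open>Of the two factors k + 1 in \<open>f k\<close>, one combines with the 2 into
      \<open>gamma_seq\<close>; the other stays in the weight.\<close>
    have f_integral: "2 * (LINT r|\<eta>. f k r) = real (Suc k) * (a\<^sup>2) ^ k * gamma_seq \<eta> k" for k
    proof -
      have "(LINT r|\<eta>. f k r) = (real k + 1)\<^sup>2 * (a\<^sup>2) ^ k * (LINT r|\<eta>. r ^ (2 * k))"
        by (simp add: f_eq)
      then show ?thesis
        by (simp only: gamma_seq_def power2_eq_square of_nat_Suc mult_ac add_ac)
    qed
    have "(\<lambda>k. LINT r|\<eta>. f k r) sums (LINT r|\<eta>. (\<Sum>k. f k r))"
    proof (rule sums_integral[OF f_int])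
      show "AE r in \<eta>. summable (\<lambda>k. norm (f k r))"
        using f_sums f_le by (intro AE_I2) (auto simp: space_eq sums_iff)
      \<comment> \<open>On \<open>[0,1)\<close> each \<open>f k\<close> is at most (k + 1)^2 a^(2k),
        which is summable by the same closed formula at a^2 < 1.\<close>
      show "summable (\<lambda>k. LINT r|\<eta>. norm (f k r))"
      proof (rule summable_comparison_test'[where N = 0])
        show "summable (\<lambda>k. (real k + 1)\<^sup>2 * (a\<^sup>2) ^ k * measure \<eta> (space \<eta>))"
          using sums_Suc_squared_powser[of "a\<^sup>2"] a2 by (intro summable_mult2) (auto simp: sums_iff)
        have "(LINT r|\<eta>. norm (f k r)) \<le> (LINT r|\<eta>. (real k + 1)\<^sup>2 * (a\<^sup>2) ^ k)" for k
          using f_le f_int by (intro integral_mono) (auto simp: space_eq)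
        then show "norm (LINT r|\<eta>. norm (f k r)) \<le> (real k + 1)\<^sup>2 * (a\<^sup>2) ^ k * measure \<eta> (space \<eta>)" for k
          by (simp add: mult_ac)
      qed
    qed
    also have "(LINT r|\<eta>. (\<Sum>k. f k r)) = (LINT r|\<eta>. (1 + a\<^sup>2 * r\<^sup>2) / (1 - a\<^sup>2 * r\<^sup>2) ^ 3)"
      using sums_unique[OF f_sums] by (intro Bochner_Integration.integral_cong) (auto simp: space_eq)
    finally have "(\<lambda>k. real (Suc k) * (a\<^sup>2) ^ k * gamma_seq \<eta> k) sums
        (2 * (LINT r|\<eta>. (1 + a\<^sup>2 * r\<^sup>2) / (1 - a\<^sup>2 * r\<^sup>2) ^ 3))"
      unfolding f_integral[symmetric] by (rule sums_mult)
    \<comment> \<open>The weights sum to 1 / (1 - a^2)^2, which cancels the prefactor of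
      \<open>beta_fun\<close>; thus the bound \<open>C\<close> for \<open>gamma_seq\<close> carries
      over unchanged.\<close>
    moreover have "(\<lambda>k. real (Suc k) * (a\<^sup>2) ^ k * C) sums (1 / (1 - a\<^sup>2)\<^sup>2 * C)"
      using a2 by (intro sums_mult2 geometric_deriv_sums) auto
    ultimately have "2 * (LINT r|\<eta>. (1 + a\<^sup>2 * r\<^sup>2) / (1 - a\<^sup>2 * r\<^sup>2) ^ 3) \<le> 1 / (1 - a\<^sup>2)\<^sup>2 * C"
      by (rule sums_le[rotated]) (intro mult_left_mono C, simp)
    from mult_left_mono[OF this, of "(1 - a\<^sup>2)\<^sup>2"] show ?thesis
      using a2 by (simp add: beta_fun_def mult_ac)
  qed
  then show ?thesis
    using beta_fun_nonneg by (intro boundedI[where B = C]) auto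
qed

section \<open>From \<open>beta_fun\<close> to \<open>kappa_fun\<close>\<close>

lemma kappa_fun_nonneg:
  assumes "0 \<le> a" "a < 1"
  shows "0 \<le> kappa_fun \<eta> a"
  using beta_integrand_bounds[OF assms, of 0] by (simp add: kappa_fun_def)

text \<open>For r in \<open>[a,1)\<close> one has 1 - a^2 r^2 <= 1 - a^4 = (1 - a^2)(1 + a^2) <= 2
  (1 - a^2), while the numerator is at least 1. Hence the integrand of \<open>beta_fun\<close> is at
  least 1 / (2 d)^3 on that interval, with d = 1 - a^2.\<close>

lemma kappa_fun_le_beta_fun:
  assumes a: "0 \<le> a" "a < 1"
  shows "kappa_fun \<eta> a \<le> 8 * beta_fun \<eta> a"
proof -
  have a2: "0 \<le> a\<^sup>2" "a\<^sup>2 < 1"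
    using beta_integrand_bounds[OF a, of 0] by auto
  define d where "d = 1 - a\<^sup>2"
  have d: "0 < d" using a2 by (simp add: d_def)
  have "1 / (2 * d) ^ 3 * measure \<eta> {a..<1} = (LINT r|\<eta>. indicat_real {a..<1} r * (1 / (2 * d) ^ 3))"
    using a by simp
  also have "\<dots> \<le> (LINT r|\<eta>. (1 + a\<^sup>2 * r\<^sup>2) / (1 - a\<^sup>2 * r\<^sup>2) ^ 3)"
  proof (rule integral_mono)
    show "integrable \<eta> (\<lambda>r. indicat_real {a..<1} r * (1 / (2 * d) ^ 3))"
      using a by (intro integrable_mult_left integrable_real_indicator) (auto simp: emeasure_eq_measure)
    fix r assume "r \<in> space \<eta>"
    then have r: "r \<in> {0..<1}" by (simp add: space_eq)
    note b = beta_integrand_bounds[OF a r]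
    have "1 / (2 * d) ^ 3 \<le> (1 + a\<^sup>2 * r\<^sup>2) / (1 - a\<^sup>2 * r\<^sup>2) ^ 3" if "a \<le> r"
    proof (rule frac_le)
      have "a\<^sup>2 * a\<^sup>2 \<le> a\<^sup>2 * r\<^sup>2"
        using that a by (intro mult_left_mono power_mono) auto
      then have "1 - a\<^sup>2 * r\<^sup>2 \<le> d * (1 + a\<^sup>2)"
        by (simp add: d_def algebra_simps)
      also have "\<dots> \<le> d * 2"
        using d a2 by (intro mult_left_mono) auto
      finally show "(1 - a\<^sup>2 * r\<^sup>2) ^ 3 \<le> (2 * d) ^ 3"
        using b by (intro power_mono) auto
    qed (use b in auto)
    moreover have "0 \<le> (1 + a\<^sup>2 * r\<^sup>2) / (1 - a\<^sup>2 * r\<^sup>2) ^ 3"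
      using b by (intro divide_nonneg_nonneg) auto
    ultimately show "indicat_real {a..<1} r * (1 / (2 * d) ^ 3) \<le> (1 + a\<^sup>2 * r\<^sup>2) / (1 - a\<^sup>2 * r\<^sup>2) ^ 3"
      by (auto split: split_indicator)
  qed (rule integrable_beta_integrand[OF a])
  finally have "1 / (2 * d) ^ 3 * measure \<eta> {a..<1} \<le> (LINT r|\<eta>. (1 + a\<^sup>2 * r\<^sup>2) / (1 - a\<^sup>2 * r\<^sup>2) ^ 3)" .
  \<comment> \<open>The factor 16 d^2 is 8 times the prefactor 2 d^2 of \<open>beta_fun\<close>, and
    16 d^2 / (2 d)^3 = 2 / d is the factor in \<open>kappa_fun\<close>.\<close>
  from mult_left_mono[OF this, of "16 * d\<^sup>2"]
  have "16 * d\<^sup>2 * (1 / (2 * d) ^ 3 * measure \<eta> {a..<1}) \<le> 8 * beta_fun \<eta> a"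
    by (simp add: beta_fun_def mult.assoc flip: d_def)
  also have "16 * d\<^sup>2 * (1 / (2 * d) ^ 3 * measure \<eta> {a..<1}) = 2 * measure \<eta> {a..<1} / d"
    using d by (simp add: power2_eq_square power3_eq_cube)
  also have "\<dots> = kappa_fun \<eta> a"
    by (simp add: kappa_fun_def d_def)
  finally show ?thesis .
qed

lemma beta_bounded_imp_kappa_bounded:
  assumes "bounded (beta_fun \<eta> ` {0..<1})"
  shows "bounded (kappa_fun \<eta> ` {0..<1})"
proof -
  obtain C where C: "\<And>a. a \<in> {0..<1} \<Longrightarrow> beta_fun \<eta> a \<le> C"
    using bounded_image_real_le[OF assms] by blast
  have "norm (kappa_fun \<eta> a) \<le> 8 * C" if "a \<in> {0..<1}" for a
    using kappa_fun_le_beta_fun[of a] C[OF that] kappa_fun_nonneg[of a] that by auto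
  then show ?thesis
    by (intro boundedI[where B = "8 * C"]) auto
qed

section \<open>From \<open>kappa_fun\<close> to \<open>gamma_seq\<close>: moments as integrals of
  tails\<close>

lemma layer_cake_power_integral:
  assumes k: "0 < k"
  shows "ennreal (LINT r|\<eta>. r ^ (2 * k)) =
    (\<integral>\<^sup>+t. ennreal (2 * real k * t ^ (2 * k - 1)) * emeasure \<eta> {t..<1} * indicator {0..1} t \<partial>lborel)"
proof -
  interpret pair_sigma_finite \<eta> "lborel :: real measure" ..
  have "ennreal (LINT r|\<eta>. r ^ (2 * k)) = (\<integral>\<^sup>+r. ennreal (r ^ (2 * k)) \<partial>\<eta>)"
    using integrable_power by (intro nn_integral_eq_integral[symmetric]) (auto simp: space_eq)
  \<comment> \<open>The power r^(2k) is the integral of its derivative over [0, r]. Stating the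
    range as a condition on the pair (t, r) prepares the exchange of integrals, after which the same
    condition cuts out the tail {t..<1}.\<close>
  also have "\<dots> = (\<integral>\<^sup>+r. (\<integral>\<^sup>+t. (if 0 \<le> t \<and> t \<le> r then ennreal (2 * real k * t ^ (2 * k - 1)) else 0) \<partial>lborel) \<partial>\<eta>)"
  proof (rule nn_integral_cong)
    fix r assume r: "r \<in> space \<eta>"
    have "(\<integral>\<^sup>+t. (if 0 \<le> t \<and> t \<le> r then ennreal (2 * real k * t ^ (2 * k - 1)) else 0) \<partial>lborel) =
        (\<integral>\<^sup>+t. ennreal (2 * real k * t ^ (2 * k - 1)) * indicator {0..r} t \<partial>lborel)"
      by (intro nn_integral_cong) (auto split: split_indicator)
    also have "\<dots> = ennreal (r ^ (2 * k) - 0 ^ (2 * k))"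
      using r k by (intro nn_integral_FTC_Icc) (auto simp: space_eq intro!: derivative_eq_intros)
    \<comment> \<open>Here \<open>0 < k\<close> matters: for k = 0 the lower endpoint would
      contribute 0^0 = 1.\<close>
    also have "\<dots> = ennreal (r ^ (2 * k))"
      using k by (simp add: power_0_left)
    finally show "ennreal (r ^ (2 * k)) =
        (\<integral>\<^sup>+t. (if 0 \<le> t \<and> t \<le> r then ennreal (2 * real k * t ^ (2 * k - 1)) else 0) \<partial>lborel)"
      by (rule sym)
  qed
  also have "\<dots> = (\<integral>\<^sup>+t. (\<integral>\<^sup>+r. (if 0 \<le> t \<and> t \<le> r then ennreal (2 * real k * t ^ (2 * k - 1)) else 0) \<partial>\<eta>) \<partial>lborel)"
    by (rule Fubini'[symmetric]) measurable
  also have "\<dots> = (\<integral>\<^sup>+t. ennreal (2 * real k * t ^ (2 * k - 1)) * emeasure \<eta> {t..<1} * indicator {0..1} t \<partial>lborel)"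
  proof (rule nn_integral_cong)
    fix t :: real
    show "(\<integral>\<^sup>+r. (if 0 \<le> t \<and> t \<le> r then ennreal (2 * real k * t ^ (2 * k - 1)) else 0) \<partial>\<eta>) =
        ennreal (2 * real k * t ^ (2 * k - 1)) * emeasure \<eta> {t..<1} * indicator {0..1} t"
    proof (cases "0 \<le> t")
      case True
      then have "(\<integral>\<^sup>+r. (if 0 \<le> t \<and> t \<le> r then ennreal (2 * real k * t ^ (2 * k - 1)) else 0) \<partial>\<eta>) =
          (\<integral>\<^sup>+r. ennreal (2 * real k * t ^ (2 * k - 1)) * indicator {t..<1} r \<partial>\<eta>)"
        by (intro nn_integral_cong) (auto simp: space_eq split: split_indicator)
      also have "\<dots> = ennreal (2 * real k * t ^ (2 * k - 1)) * emeasure \<eta> {t..<1}"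
        using True by (simp add: nn_integral_cmult_indicator)
      \<comment> \<open>For t > 1 the tail is empty, so the indicator of {0..1} changes
        nothing.\<close>
      finally show ?thesis
        using True by (cases "t \<le> 1") auto
    qed simp
  qed
  finally show ?thesis .
qed

lemma kappa_bounded_imp_gamma_bounded:
  assumes "bounded (kappa_fun \<eta> ` {0..<1})"
  shows "bounded (range (gamma_seq \<eta>))"
proof -
  obtain C where C: "\<And>t. t \<in> {0..<1} \<Longrightarrow> kappa_fun \<eta> t \<le> C"
    using bounded_image_real_le[OF assms] by blast
  have C0: "0 \<le> C"
    using C[of 0] kappa_fun_nonneg[of 0] by simp
  \<comment> \<open>The bound on \<open>kappa_fun\<close> covers t < 1; at t = 1 both sides are 0,
    which extends the estimate to the closed interval of integration.\<close>
  have tail: "measure \<eta> {t..<1} \<le> C / 2 * (1 - t\<^sup>2)" if t: "0 \<le> t" "t \<le> 1" for t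
  proof (cases "t = 1")
    case False
    then have "0 < 1 - t\<^sup>2"
      using beta_integrand_bounds[of t 0] t by auto
    then show ?thesis
      using C[of t] False t by (simp add: kappa_fun_def field_simps)
  qed simp
  have "gamma_seq \<eta> k \<le> C" for k
  proof (cases "k = 0")
    \<comment> \<open>The layer cake formula requires a positive exponent, but directly
      \<open>gamma_seq \<eta> 0\<close> is twice the total mass, which is
      \<open>kappa_fun \<eta> 0\<close>.\<close>
    case True
    then show ?thesis
      using C[of 0] by (simp add: gamma_seq_def kappa_fun_def space_eq)
  next
    case False
    then have k: "0 < k" by simp
    \<comment> \<open>An antiderivative of the tail bound C/2 (1 - t^2) times 2k t^(2k - 1). Its
      increment over [0, 1] is C / (2 (k + 1)), so the factor 2 (k + 1) in \<open>gamma_seq\<close>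
      returns exactly \<open>C\<close>.\<close>
    define F where "F t = C / 2 * (t ^ (2 * k) - real k / (real k + 1) * t ^ (2 * k + 2))" for t :: real
    have "ennreal (LINT r|\<eta>. r ^ (2 * k)) \<le>
        (\<integral>\<^sup>+t. ennreal (2 * real k * t ^ (2 * k - 1) * (C / 2 * (1 - t\<^sup>2))) * indicator {0..1} t \<partial>lborel)"
      unfolding layer_cake_power_integral[OF k]
    proof (rule nn_integral_mono)
      fix t :: real
      have "ennreal (2 * real k * t ^ (2 * k - 1)) * emeasure \<eta> {t..<1} \<le>
          ennreal (2 * real k * t ^ (2 * k - 1) * (C / 2 * (1 - t\<^sup>2)))" if t: "0 \<le> t" "t \<le> 1"
        using tail[OF t] t
        by (subst ennreal_mult') (auto simp: emeasure_eq_measure intro!: mult_left_mono ennreal_leI)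
      then show "ennreal (2 * real k * t ^ (2 * k - 1)) * emeasure \<eta> {t..<1} * indicator {0..1} t \<le>
          ennreal (2 * real k * t ^ (2 * k - 1) * (C / 2 * (1 - t\<^sup>2))) * indicator {0..1} t"
        by (auto split: split_indicator)
    qed
    also have "\<dots> = ennreal (F 1 - F 0)"
    proof (rule nn_integral_FTC_Icc)
      fix t :: real assume "t \<in> {0..1}"
      then have t: "0 \<le> t" "t \<le> 1" by auto
      have "(F has_real_derivative C / 2 * (real (2 * k) * t ^ (2 * k - 1) -
          real k / (real k + 1) * (real (2 * k + 2) * t ^ (2 * k + 2 - 1)))) (at t)"
        unfolding F_def One_nat_def by (intro DERIV_cmult DERIV_diff DERIV_pow)
      also have "real k / (real k + 1) * (real (2 * k + 2) * t ^ (2 * k + 2 - 1)) =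
          2 * real k * (t\<^sup>2 * t ^ (2 * k - 1))"
        using False by (simp add: field_simps flip: power_add)
      finally show "(F has_real_derivative 2 * real k * t ^ (2 * k - 1) * (C / 2 * (1 - t\<^sup>2))) (at t)"
        by (simp add: algebra_simps)
      show "0 \<le> 2 * real k * t ^ (2 * k - 1) * (C / 2 * (1 - t\<^sup>2))"
        using t C0 by (auto intro!: mult_nonneg_nonneg simp: power_le_one)
    qed auto
    also have "F 1 - F 0 = C / (2 * (real k + 1))"
      using False by (simp add: F_def power_0_left field_simps)
    finally have "(LINT r|\<eta>. r ^ (2 * k)) \<le> C / (2 * (real k + 1))"
      using C0 by (simp add: ennreal_le_iff)
    then show ?thesis
      by (simp add: gamma_seq_def field_simps)
  qed
  then show ?thesis
    using gamma_seq_nonneg by (intro boundedI[where B = C]) auto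
qed

end

theorem theorem6p1:
  fixes \<eta> :: "real measure" and \<mu> :: "complex measure"
  assumes "finite_measure \<eta>"
    and "sets \<eta> = sets (restrict_space borel {0..<1})"
    and "\<mu> = radial_measure \<eta>"
  shows "(toeplitz_bounded \<mu> \<longleftrightarrow> bounded (beta_fun \<eta> ` {0..<1})) \<and>
         (bounded (beta_fun \<eta> ` {0..<1}) \<longleftrightarrow> bounded (range (gamma_seq \<eta>))) \<and>
         (bounded (range (gamma_seq \<eta>)) \<longleftrightarrow> bounded (kappa_fun \<eta> ` {0..<1}))"
proof -
  interpret unit_interval_measure \<eta>
    using assms(1,2) by (simp add: unit_interval_measure_def unit_interval_measure_axioms_def)
  show ?thesis
    unfolding assms(3)
    using toeplitz_bounded_imp_gamma_bounded gamma_bounded_imp_toeplitz_bounded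
      gamma_bounded_imp_beta_bounded beta_bounded_imp_kappa_bounded kappa_bounded_imp_gamma_bounded
    by blast
qed

end
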